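(* For a greedy reading policy, with probability one, $$\limsup_{n\to\infty}\frac{R_{\mathbf G}(n)-n/2}{\sqrt{2\sigma_{R_{\mathbf G}}^2 n\log_2 n}}=1=-\liminf_{n\to\infty}\frac{R_{\mathbf G}(n)-n/2}{\sqrt{2\sigma_{R_{\mathbf G}}^2 n\log_2 n}},\qquad\sigma_{R_{\mathbf G}}^2:=\frac{\sigma_{\mathbf R}^2+\sigma_{\mathbf S}^2}{8\mu^2}.$$
   Context: Let $(r_i)_{i\ge1}$, $(s_i)_{i\ge1}$ be probability vectors on the positive integers with $\mu:=\sum_i r_is_i>0$. Let $\{L_{\mathbf R}(n)\}_{n\ge1}$, $\{L_{\mathbf S}(n)\}_{n\ge1}$ be independent i.i.d. sequences with $\Pr(L_{\mathbf R}(1)=i)=r_i$, $\Pr(L_{\mathbf S}(1)=i)=s_i$. Put $X_{\mathbf R}(n)=s_{L_{\mathbf R}(n)}$, $X_{\mathbf S}(n)=r_{L_{\mathbf S}(n)}$ (common mean $\mu$, variances $\sigma_{\mathbf R}^2,\sigma_{\mathbf S}^2$; standing assumption $\sigma_{\mathbf R}+\sigma_{\mathbf S}>0$), and $\Gamma_{\mathbf R}[m]=\sum_{j=1}^mX_{\mathbf R}(j)$, $\Gamma_{\mathbf S}[m]=\sum_{j=1}^mX_{\mathbf S}(j)$. A reading policy is a $\{0,1\}$-valued process $C(n)$ ($C(n)=1$ iff the $n$-th record is read from $\mathbf R$), $R(n)=\sum_{j\le n}C(j)$, $S(n)=n-R(n)$, with $C(n)$ being $\mathcal F_{n-1}$-measurable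 where $\mathcal F_n=\mathcal F_0\vee\sigma(L_{\mathbf R}(1),\dots,L_{\mathbf R}(R(n));L_{\mathbf S}(1),\dots,L_{\mathbf S}(S(n)))$ and $\mathcal F_0$ (randomization) is independent of the labels. A greedy policy satisfies, for $n\ge1$, $C(n+1)=1$ if $\Gamma_{\mathbf S}[S(n)]>\Gamma_{\mathbf R}[R(n)]$ and $C(n+1)=0$ if $\Gamma_{\mathbf S}[S(n)]<\Gamma_{\mathbf R}[R(n)]$ (ties arbitrary); the subscript $\mathbf G$ refers to it. $\log_2 n=\log\log n$. *)

theory Defs
  imports "HOL-Probability.Probability"
begin

text \<open>Number of records read from R among the first n reads (C j = 1 iff j-th read is from R).\<close>
definition readR :: "(nat \<Rightarrow> 'a \<Rightarrow> nat) \<Rightarrow> nat \<Rightarrow> 'a \<Rightarrow> nat" where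
  "readR C n \<omega> = (\<Sum>j\<in>{1..n}. C j \<omega>)"

definition readS :: "(nat \<Rightarrow> 'a \<Rightarrow> nat) \<Rightarrow> nat \<Rightarrow> 'a \<Rightarrow> nat" where
  "readS C n \<omega> = n - readR C n \<omega>"

definition Gam :: "(nat \<Rightarrow> real) \<Rightarrow> (nat \<Rightarrow> 'a \<Rightarrow> nat) \<Rightarrow> nat \<Rightarrow> 'a \<Rightarrow> real" where
  "Gam f L m \<omega> = (\<Sum>j\<in>{1..m}. f (L j \<omega>))"

text \<open>Generators of F_n = F_0 v sigma(L_R(1..R(n)); L_S(1..S(n))): the stopped label
  sequences (label if already read, 0 otherwise; labels are positive).\<close>
definition info_sets :: "'a measure \<Rightarrow> 'a set set \<Rightarrow> (nat \<Rightarrow> 'a \<Rightarrow> nat) \<Rightarrow> (nat \<Rightarrow> 'a \<Rightarrow> nat)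
    \<Rightarrow> (nat \<Rightarrow> 'a \<Rightarrow> nat) \<Rightarrow> nat \<Rightarrow> 'a set set" where
  "info_sets M F0 LR LS C n = F0
     \<union> (\<Union>j\<in>{1..}. \<Union>i. {{\<omega>\<in>space M. (if j \<le> readR C n \<omega> then LR j \<omega> else 0) = i}})
     \<union> (\<Union>j\<in>{1..}. \<Union>i. {{\<omega>\<in>space M. (if j \<le> readS C n \<omega> then LS j \<omega> else 0) = i}})"

definition filt :: "'a measure \<Rightarrow> 'a set set \<Rightarrow> (nat \<Rightarrow> 'a \<Rightarrow> nat) \<Rightarrow> (nat \<Rightarrow> 'a \<Rightarrow> nat)
    \<Rightarrow> (nat \<Rightarrow> 'a \<Rightarrow> nat) \<Rightarrow> nat \<Rightarrow> 'a measure" where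
  "filt M F0 LR LS C n = sigma (space M) (info_sets M F0 LR LS C n)"

definition label_sets :: "'a measure \<Rightarrow> (nat \<Rightarrow> 'a \<Rightarrow> nat) \<Rightarrow> (nat \<Rightarrow> 'a \<Rightarrow> nat) \<Rightarrow> 'a set set" where
  "label_sets M LR LS = sigma_sets (space M)
     ((\<Union>j\<in>{1..}. \<Union>i. {{\<omega>\<in>space M. LR j \<omega> = i}}) \<union> (\<Union>j\<in>{1..}. \<Union>i. {{\<omega>\<in>space M. LS j \<omega> = i}}))"

end

theory Submission
  imports Defs "HOL-Real_Asymp.Real_Asymp"
begin

text \<open>Greediness keeps the two counters \<open>\<Gamma>\<^sub>R[R(n)]\<close> and \<open>\<Gamma>\<^sub>S[S(n)]\<close> within distance 1, whatever the
  tie-breaking. Writing \<open>\<Gamma>\<^sub>R[m] = \<mu> m + U m\<close> and \<open>\<Gamma>\<^sub>S[m] = \<mu> m + V m\<close>, this says that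
  \<open>2 \<mu> (R(n) - n / 2) = V (S(n)) - U (R(n)) + O(1)\<close>. By Hoeffding's inequality and Borel--Cantelli,
  \<open>R(n)\<close> and \<open>S(n)\<close> differ from \<open>n / 2\<close> by \<open>O(sqrt (n log n))\<close>, and over windows of that length \<open>U\<close> and \<open>V\<close>
  move by \<open>o(sqrt n)\<close> only; so up to \<open>o(sqrt n)\<close> the right-hand side is \<open>(V - U) (n / 2)\<close>. As \<open>V - U\<close> is a walk with
  bounded centered i.i.d. increments of variance \<open>\<sigma>\<^sub>R\<^sup>2 + \<sigma>\<^sub>S\<^sup>2\<close>, the claim is its law of the iterated
  logarithm.\<close>

text \<open>The obstacle is that \<open>R(n)\<close> and \<open>S(n)\<close> are random times that
  depend on the labels, so limit theorems at fixed times say nothing about \<open>U (R(n))\<close>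
  and \<open>V (S(n))\<close>. The increments are therefore controlled simultaneously over all
  windows inside the first n steps. After that the comparison with time n / 2 is a deterministic
  statement about each sample path, whatever the dependence between policy and labels. The constant:
  \<open>V - U\<close> at time n / 2 has variance \<open>(\<sigma>\<^sub>R\<^sup>2 +
  \<sigma>\<^sub>S\<^sup>2) * n / 2\<close>, and dividing the walk by \<open>2 * \<mu>\<close> turns
  this into n times the variance in the claim. The liminf comes from applying both halves of the
  iterated logarithm law to the negated walk.\<close>

section \<open>The upper half of the law of the iterated logarithm\<close>

text \<open>If the event \<open>B\<close> of no success from \<open>k\<close> on had positive
  probability, independence and \<open>1 - p \<le> exp (- p)\<close> would bound all partial sums of
  the success probabilities. Each variable has its own target space \<open>N n\<close> because
  \<open>S_lower\<close> applies this to whole blocks of the walk, taken as elements of product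
  spaces.\<close>

lemma (in prob_space) borel_cantelli_2_AE:
  fixes G :: "nat \<Rightarrow> 'b set"
  assumes indep: "indep_vars N X UNIV"
    and G: "\<And>n. G n \<in> sets (N n)"
    and div: "\<not> summable (\<lambda>n. prob {\<omega>\<in>space M. X n \<omega> \<in> G n})"
  shows "AE \<omega> in M. \<exists>\<^sub>F n in sequentially. X n \<omega> \<in> G n"
proof -
  define p where "p n = prob {\<omega>\<in>space M. X n \<omega> \<in> G n}" for n
  have X[measurable]: "X n \<in> measurable M (N n)" for n
    using indep by (auto simp: indep_vars_def)
  note G[measurable]
  have "AE \<omega> in M. \<exists>n\<ge>k. X n \<omega> \<in> G n" for k
  proof -
    define B where "B = {\<omega>\<in>space M. \<forall>n\<ge>k. X n \<omega> \<notin> G n}"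
    have B[measurable]: "B \<in> sets M" unfolding B_def by measurable
    have le: "prob B \<le> exp (- (\<Sum>n\<in>{k..<k + Suc j}. p n))" for j
    proof -
      have "prob B \<le> prob (\<Inter>n\<in>{k..<k + Suc j}. X n -` (space (N n) - G n) \<inter> space M)"
        using measurable_space[OF X]
        by (intro finite_measure_mono) (auto simp: B_def intro!: sets.finite_INT)
      also have "\<dots> = (\<Prod>n\<in>{k..<k + Suc j}. prob (X n -` (space (N n) - G n) \<inter> space M))"
        by (intro indep_varsD[OF indep]) auto
      also have "\<dots> = (\<Prod>n\<in>{k..<k + Suc j}. 1 - p n)"
      proof (intro prod.cong refl)
        fix n
        have "X n -` (space (N n) - G n) \<inter> space M = space M - {\<omega>\<in>space M. X n \<omega> \<in> G n}"
          using measurable_space[OF X] by auto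
        then show "prob (X n -` (space (N n) - G n) \<inter> space M) = 1 - p n"
          unfolding p_def by (simp add: prob_compl)
      qed
      also have "\<dots> \<le> (\<Prod>n\<in>{k..<k + Suc j}. exp (- p n))"
        by (intro prod_mono) (use exp_ge_add_one_self[of "- p _"] in \<open>auto simp: p_def\<close>)
      also have "\<dots> = exp (- (\<Sum>n\<in>{k..<k + Suc j}. p n))"
        by (simp only: exp_sum[OF finite_atLeastLessThan] sum_negf[symmetric])
      finally show ?thesis .
    qed
    have "prob B \<le> 0"
    proof (rule ccontr)
      assume "\<not> prob B \<le> 0"
      have bnd: "(\<Sum>n<j. p (n + k)) \<le> - ln (prob B)" for j
      proof -
        have "(\<Sum>n<j. p (n + k)) \<le> (\<Sum>n<Suc j. p (n + k))"
          by (simp add: p_def)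
        also have "\<dots> = (\<Sum>n\<in>{k..<k + Suc j}. p n)"
          using sum.shift_bounds_nat_ivl[of p 0 k "Suc j"] by (simp add: atLeast0LessThan add.commute)
        also have "\<dots> \<le> - ln (prob B)"
          using ln_mono[OF le[of j]] \<open>\<not> prob B \<le> 0\<close> by simp
        finally show ?thesis .
      qed
      have "summable (\<lambda>n. p (n + k))"
        by (rule bounded_imp_summable[of _ "- ln (prob B)"])
          (use bnd[of "Suc _"] in \<open>auto simp: p_def lessThan_Suc_atMost\<close>)
      then show False
        using div summable_iff_shift[of p k] unfolding p_def by simp
    qed
    then have "prob B = 0" by (simp add: order_antisym)
    then have "AE \<omega> in M. \<omega> \<notin> B"
      by (subst (asm) prob_eq_0) auto
    then show ?thesis
      by (rule AE_mp) (auto simp: B_def)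
  qed
  then have "AE \<omega> in M. \<forall>k. \<exists>n\<ge>k. X n \<omega> \<in> G n"
    by (simp add: AE_all_countable)
  then show ?thesis
    by (simp add: frequently_sequentially)
qed

text \<open>The Lagrange remainder \<open>exp t * x ^ 3 / 6\<close> is at most half of
  \<open>\<bar>x\<bar> ^ 3\<close> because \<open>exp t \<le> 3\<close>. It is written as a factor
  on the quadratic term that tends to 1 at 0, since a sharp iterated logarithm law needs the exact
  leading coefficient.\<close>

lemma exp_le_cubic:
  fixes x :: real
  assumes "\<bar>x\<bar> \<le> 1"
  shows "exp x \<le> 1 + x + x\<^sup>2 / 2 * (1 + \<bar>x\<bar>)"
proof -
  obtain t where t: "\<bar>t\<bar> \<le> \<bar>x\<bar>" "exp x = (\<Sum>m<3. x ^ m / fact m) + exp t / fact 3 * x ^ 3"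
    using Maclaurin_exp_le[of x 3] by blast
  have "exp t \<le> exp 1" using t assms by simp
  then have "exp t \<le> 3" using exp_le by linarith
  have "exp t * x ^ 3 \<le> 3 * \<bar>x\<bar> ^ 3"
    using \<open>exp t \<le> 3\<close> by (intro order.trans[OF mult_left_mono[of _ "\<bar>x\<bar> ^ 3"] mult_right_mono])
      (auto simp flip: power_abs)
  then show ?thesis
    unfolding t(2) by (simp add: numeral_3_eq_3 fact_numeral power2_eq_square algebra_simps)
qed

text \<open>The bound 1 fits steps that are differences of two numbers in the unit interval. As
  \<open>\<phi>\<close> below depends on \<open>v\<close> alone, a walk and its negative share
  it.\<close>

locale centered_iid = prob_space +
  fixes Y :: "nat \<Rightarrow> 'a \<Rightarrow> real" and v :: real
  assumes indep: "indep_vars (\<lambda>_. borel) Y UNIV"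
    and bdd: "\<And>n \<omega>. \<omega> \<in> space M \<Longrightarrow> \<bar>Y n \<omega>\<bar> \<le> 1"
    and mean: "\<And>n. expectation (Y n) = 0"
    and second_moment: "\<And>n. expectation (\<lambda>\<omega>. (Y n \<omega>)\<^sup>2) = v"
    and v_pos: "v > 0"
    and identical: "\<And>n. distr M borel (Y n) = distr M borel (Y 0)"
begin

definition S :: "nat \<Rightarrow> 'a \<Rightarrow> real" where "S n \<omega> = (\<Sum>i<n. Y i \<omega>)"

text \<open>The argument is real because the upper half evaluates the envelope at powers of a real
  \<open>c\<close>.\<close>

definition \<phi> :: "real \<Rightarrow> real" where "\<phi> x = sqrt (2 * v * x * ln (ln x))"

lemma Y_measurable[measurable]: "Y n \<in> borel_measurable M"
  using indep by (auto simp: indep_vars_def)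

lemma S_measurable[measurable]: "S n \<in> borel_measurable M"
  unfolding S_def by measurable

lemma S_0[simp]: "S 0 \<omega> = 0" and S_Suc: "S (Suc n) \<omega> = S n \<omega> + Y n \<omega>"
  by (simp_all add: S_def)

lemma bdd_S: "\<omega> \<in> space M \<Longrightarrow> \<bar>S n \<omega>\<bar> \<le> n"
proof (induction n)
  case (Suc n)
  then show ?case using bdd[of \<omega> n] by (simp add: S_Suc)
qed simp

lemma Y_integrable[simp]: "integrable M (Y n)" "integrable M (\<lambda>\<omega>. (Y n \<omega>)\<^sup>2)"
  by (rule integrable_const_bound[of _ 1]; use bdd in \<open>auto simp: abs_square_le_1\<close>)+

text \<open>Bound for the logarithm of the moment generating function of one step: the Gaussian
  value \<open>l\<^sup>2 * v / 2\<close> with a correction factor tending to 1.\<close>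

definition \<psi> :: "real \<Rightarrow> real" where "\<psi> l = l\<^sup>2 * v / 2 * (1 + l)"

lemma exp_Y_integrable: "integrable M (\<lambda>\<omega>. exp (l * Y n \<omega>))"
proof (rule integrable_const_bound[of _ "exp \<bar>l\<bar>"])
  have "l * Y n \<omega> \<le> \<bar>l\<bar>" if "\<omega> \<in> space M" for \<omega>
  proof -
    have "l * Y n \<omega> \<le> \<bar>l\<bar> * \<bar>Y n \<omega>\<bar>" by (metis abs_ge_self abs_mult)
    also have "\<dots> \<le> \<bar>l\<bar> * 1" using bdd[OF that] by (intro mult_left_mono) auto
    finally show ?thesis by simp
  qed
  then show "AE \<omega> in M. norm (exp (l * Y n \<omega>)) \<le> exp \<bar>l\<bar>" by simp
qed simp

lemma mgf_le:
  assumes "0 \<le> l" "l \<le> 1"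
  shows "expectation (\<lambda>\<omega>. exp (l * Y n \<omega>)) \<le> exp (\<psi> l)"
proof -
  have "expectation (\<lambda>\<omega>. exp (l * Y n \<omega>))
      \<le> expectation (\<lambda>\<omega>. 1 + l * Y n \<omega> + (l\<^sup>2 / 2 * (1 + l)) * (Y n \<omega>)\<^sup>2)"
  proof (rule integral_mono)
    fix \<omega> assume \<omega>: "\<omega> \<in> space M"
    have le: "\<bar>l * Y n \<omega>\<bar> \<le> l"
      using bdd[OF \<omega>, of n] assms by (simp add: abs_mult mult_left_le)
    then have "exp (l * Y n \<omega>) \<le> 1 + l * Y n \<omega> + (l * Y n \<omega>)\<^sup>2 / 2 * (1 + \<bar>l * Y n \<omega>\<bar>)"
      using assms by (intro exp_le_cubic) auto
    also have "\<dots> \<le> 1 + l * Y n \<omega> + (l * Y n \<omega>)\<^sup>2 / 2 * (1 + l)"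
      using le by (intro add_left_mono mult_left_mono) auto
    finally show "exp (l * Y n \<omega>) \<le> 1 + l * Y n \<omega> + (l\<^sup>2 / 2 * (1 + l)) * (Y n \<omega>)\<^sup>2"
      by (simp add: power_mult_distrib mult_ac)
  qed (auto intro!: exp_Y_integrable)
  also have "\<dots> = 1 + \<psi> l"
    by (simp add: mean second_moment prob_space \<psi>_def)
  also have "\<dots> \<le> exp (\<psi> l)" by (rule exp_ge_add_one_self)
  finally show ?thesis .
qed

text \<open>For the supermartingale \<open>exp (l * S k - k * \<psi> l)\<close>: on each step the
  mass of the paths crossing the level is traded against the mass of those that stay below it.\<close>

lemma prob_max_S_ge:
  fixes N :: nat
  assumes l: "0 \<le> l" "l \<le> 1"
  shows "prob {\<omega>\<in>space M. \<exists>n\<le>N. S n \<omega> \<ge> x} \<le> exp (N * \<psi> l - l * x)"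
proof -
  have \<psi>: "\<psi> l \<ge> 0" using l v_pos by (simp add: \<psi>_def)
  \<comment> \<open>A lower bound for \<open>Z j\<close> whenever \<open>j \<le> N\<close> and
    \<open>S j \<ge> x\<close>; it converts expectation on the crossing paths into
    probability.\<close>
  define a where "a = exp (l * x - N * \<psi> l)"
  define B where "B k = {\<omega>\<in>space M. \<forall>j\<le>k. S j \<omega> < x}" for k
  define Z where "Z k \<omega> = exp (l * S k \<omega> - k * \<psi> l)" for k \<omega>
  have [measurable]: "B k \<in> sets M" for k unfolding B_def by measurable
  have [measurable]: "Z k \<in> borel_measurable M" for k unfolding Z_def by measurable
  have Z_le: "\<bar>Z k \<omega>\<bar> \<le> exp k" if "\<omega> \<in> space M" for k \<omega>
  proof -
    have "l * S k \<omega> \<le> l * real k"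
      using bdd_S[OF that, of k] l by (intro mult_left_mono) auto
    also have "\<dots> \<le> real k" using l by (simp add: mult_left_le_one_le)
    finally have "l * S k \<omega> \<le> real k" .
    then show ?thesis using \<psi> by (auto simp: Z_def intro: order.trans[of _ "l * S k \<omega>"])
  qed
  have intZ[simp]: "integrable M (\<lambda>\<omega>. Z j \<omega> * indicator A \<omega>)" if [measurable]: "A \<in> sets M" for j A
    by (rule integrable_const_bound[of _ "exp j"]) (use Z_le[of _ j] in \<open>auto simp: indicator_def\<close>)
  have [simp]: "integrable M (\<lambda>\<omega>. indicator (B k - B (Suc k)) \<omega> :: real)" for k
    by (intro integrable_real_indicator) (auto simp: emeasure_eq_measure)
  have B_Suc: "B (Suc k) \<subseteq> B k" for k unfolding B_def by auto
  have step: "expectation (\<lambda>\<omega>. Z (Suc k) \<omega> * indicator (B k) \<omega>) \<le> expectation (\<lambda>\<omega>. Z k \<omega> * indicator (B k) \<omega>)" for k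
  proof -
    \<comment> \<open>\<open>Z k\<close> on \<open>B k\<close> as a function of the steps before
      \<open>k\<close> only, hence independent of the factor that \<open>Y k\<close> contributes to
      \<open>Z (Suc k)\<close>.\<close>
    define F where "F g = exp (l * (\<Sum>i<k. g i) - k * \<psi> l) *
        indicator {g \<in> space (PiM {..<k} (\<lambda>_. borel)). \<forall>j\<le>k. (\<Sum>i<j. g i) < x} g"
      for g :: "nat \<Rightarrow> real"
    have [measurable]: "(\<lambda>g. \<Sum>i<j. g i :: real) \<in> borel_measurable (PiM {..<k} (\<lambda>_. borel))" if "j \<le> k" for j
      using that by (intro borel_measurable_sum measurable_component_singleton) auto
    have "Measurable.pred (PiM {..<k} (\<lambda>_. borel)) (\<lambda>g. \<forall>j\<in>{..k}. (\<Sum>i<j. g i) < x)"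
      by (intro pred_intros_finite) (auto simp: Measurable.pred_def intro!: borel_measurable_less)
    then have [measurable]: "{g \<in> space (PiM {..<k} (\<lambda>_. borel)). \<forall>j\<le>k. (\<Sum>i<j. g i) < x} \<in> sets (PiM {..<k} (\<lambda>_. borel))"
      by (simp add: Ball_def Measurable.pred_def)
    have F[measurable]: "F \<in> borel_measurable (PiM {..<k} (\<lambda>_. borel))"
      unfolding F_def by measurable
    have indep_F: "indep_var borel (F \<circ> (\<lambda>\<omega>. restrict (\<lambda>i. Y i \<omega>) {..<k}))
        borel ((\<lambda>g. exp (l * g k - \<psi> l)) \<circ> (\<lambda>\<omega>. restrict (\<lambda>i. Y i \<omega>) {k}))"
      by (intro indep_var_compose[OF indep_var_restrict[OF indep]]) auto
    have F_eq: "(F \<circ> (\<lambda>\<omega>. restrict (\<lambda>i. Y i \<omega>) {..<k})) \<omega> = Z k \<omega> * indicator (B k) \<omega>" if "\<omega> \<in> space M" for \<omega>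
    proof -
      have "(\<Sum>i<j. restrict (\<lambda>i. Y i \<omega>) {..<k} i) = S j \<omega>" if "j \<le> k" for j
        using that unfolding S_def by (intro sum.cong) auto
      then show ?thesis using \<open>\<omega> \<in> space M\<close>
        by (auto simp: F_def Z_def B_def space_PiM indicator_def)
    qed
    have Z_Suc: "Z (Suc k) \<omega> = Z k \<omega> * exp (l * Y k \<omega> - \<psi> l)" for \<omega>
      by (simp add: Z_def S_Suc algebra_simps flip: exp_add)
    have intE: "integrable M (\<lambda>\<omega>. exp (l * Y k \<omega> - \<psi> l))"
      using exp_Y_integrable[of l k] by (simp add: exp_diff)
    have "expectation (\<lambda>\<omega>. Z (Suc k) \<omega> * indicator (B k) \<omega>)
        = expectation (\<lambda>\<omega>. (F \<circ> (\<lambda>\<omega>. restrict (\<lambda>i. Y i \<omega>) {..<k})) \<omega> *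
            ((\<lambda>g. exp (l * g k - \<psi> l)) \<circ> (\<lambda>\<omega>. restrict (\<lambda>i. Y i \<omega>) {k})) \<omega>)"
      by (intro Bochner_Integration.integral_cong refl) (simp add: F_eq Z_Suc del: o_apply, simp)
    also have "\<dots> = expectation (F \<circ> (\<lambda>\<omega>. restrict (\<lambda>i. Y i \<omega>) {..<k})) *
        expectation ((\<lambda>g. exp (l * g k - \<psi> l)) \<circ> (\<lambda>\<omega>. restrict (\<lambda>i. Y i \<omega>) {k}))"
    proof (rule indep_var_lebesgue_integral[OF indep_F])
      show "integrable M (F \<circ> (\<lambda>\<omega>. restrict (\<lambda>i. Y i \<omega>) {..<k}))"
        by (subst Bochner_Integration.integrable_cong[OF refl F_eq]) auto
      show "integrable M ((\<lambda>g. exp (l * g k - \<psi> l)) \<circ> (\<lambda>\<omega>. restrict (\<lambda>i. Y i \<omega>) {k}))"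
        using intE by (simp add: comp_def)
    qed
    also have "expectation ((\<lambda>g. exp (l * g k - \<psi> l)) \<circ> (\<lambda>\<omega>. restrict (\<lambda>i. Y i \<omega>) {k}))
       = expectation (\<lambda>\<omega>. exp (l * Y k \<omega>)) / exp (\<psi> l)"
      by (simp add: comp_def exp_diff)
    also have "expectation (F \<circ> (\<lambda>\<omega>. restrict (\<lambda>i. Y i \<omega>) {..<k})) = expectation (\<lambda>\<omega>. Z k \<omega> * indicator (B k) \<omega>)"
      by (intro Bochner_Integration.integral_cong refl F_eq)
    also have "expectation (\<lambda>\<omega>. Z k \<omega> * indicator (B k) \<omega>) * (expectation (\<lambda>\<omega>. exp (l * Y k \<omega>)) / exp (\<psi> l))
        \<le> expectation (\<lambda>\<omega>. Z k \<omega> * indicator (B k) \<omega>) * 1"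
      using mgf_le[OF l, of k]
      by (intro mult_left_mono) (auto simp: divide_le_eq_1 Z_def intro!: integral_nonneg_AE)
    finally show ?thesis by simp
  qed
  have inv: "a * (1 - prob (B k)) + expectation (\<lambda>\<omega>. Z k \<omega> * indicator (B k) \<omega>) \<le> 1" if "k \<le> N" for k
    using that
  proof (induction k)
    case 0
    \<comment> \<open>The level may have any sign. If \<open>x \<le> 0\<close>, all paths have
      crossed at time 0, and then \<open>a \<le> 1\<close>.\<close>
    have "B 0 = (if x > 0 then space M else {})" by (auto simp: B_def)
    moreover have "a \<le> 1" if "x \<le> 0"
      using that l \<psi> by (auto simp: a_def mult_nonneg_nonpos intro: order.trans[of _ 0])
    ultimately show ?case by (auto simp: Z_def prob_space)
  next
    case (Suc k)
    have "a * (prob (B k) - prob (B (Suc k))) + expectation (\<lambda>\<omega>. Z (Suc k) \<omega> * indicator (B (Suc k)) \<omega>)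
       = expectation (\<lambda>\<omega>. a * indicator (B k - B (Suc k)) \<omega> + Z (Suc k) \<omega> * indicator (B (Suc k)) \<omega>)"
      using B_Suc[of k] by (subst Bochner_Integration.integral_add) (auto simp: finite_measure_Diff)
    also have "\<dots> \<le> expectation (\<lambda>\<omega>. Z (Suc k) \<omega> * indicator (B k) \<omega>)"
    proof (rule integral_mono)
      fix \<omega> assume \<omega>: "\<omega> \<in> space M"
      have "a \<le> Z (Suc k) \<omega>" if "\<omega> \<in> B k" "\<omega> \<notin> B (Suc k)"
      proof -
        have "S (Suc k) \<omega> \<ge> x"
          using that by (auto simp: B_def not_less le_Suc_eq)
        moreover have "real (Suc k) * \<psi> l \<le> real N * \<psi> l"
          using Suc.prems \<psi> by (intro mult_right_mono) auto
        ultimately show ?thesis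
          using l unfolding a_def Z_def by (auto intro!: diff_mono mult_left_mono)
      qed
      then show "a * indicator (B k - B (Suc k)) \<omega> + Z (Suc k) \<omega> * indicator (B (Suc k)) \<omega> \<le> Z (Suc k) \<omega> * indicator (B k) \<omega>"
        using B_Suc[of k] by (auto simp: indicator_def)
    qed auto
    also have "\<dots> \<le> expectation (\<lambda>\<omega>. Z k \<omega> * indicator (B k) \<omega>)" by (rule step)
    finally show ?case using Suc by (simp add: algebra_simps)
  qed
  have "{\<omega>\<in>space M. \<exists>n\<le>N. S n \<omega> \<ge> x} = space M - B N"
    by (auto simp: B_def not_less)
  then have "a * prob {\<omega>\<in>space M. \<exists>n\<le>N. S n \<omega> \<ge> x} = a * (1 - prob (B N))"
    by (simp add: prob_compl)
  also have "\<dots> \<le> a * (1 - prob (B N)) + expectation (\<lambda>\<omega>. Z N \<omega> * indicator (B N) \<omega>)"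
    by (auto simp: Z_def intro!: integral_nonneg_AE)
  also have "\<dots> \<le> 1" using inv[of N] by simp
  finally show ?thesis
    by (simp add: a_def exp_diff field_simps)
qed

end

section \<open>Almost sure upper bound along geometric blocks\<close>

context centered_iid begin

lemma \<phi>_mono:
  assumes "exp 1 \<le> x" "x \<le> y"
  shows "\<phi> x \<le> \<phi> y"
proof -
  have e: "exp 1 > (1::real)" by simp
  have x: "x > 1" "y > 1" using assms e by linarith+
  have "ln x \<ge> 1" using assms(1) x by (subst ln_ge_iff) auto
  moreover have "ln x \<le> ln y" using assms x by simp
  ultimately have "0 \<le> ln (ln x)" "ln (ln x) \<le> ln (ln y)" by auto
  then show ?thesis using v_pos x assms unfolding \<phi>_def
    by (intro real_sqrt_le_mono mult_mono) auto
qed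

text \<open>Along \<open>c ^ k\<close> the optimal tilting parameter for the maximal inequality on the block
  up to \<open>c ^ Suc k\<close> is \<open>x / (v * c ^ Suc k)\<close>; the loss from passing to the
  end of the block is the factor \<open>c\<close>, which the factor \<open>c\<^sup>2\<close> in \<open>x\<^sup>2\<close> compensates.\<close>

lemma S_upper:
  assumes c: "c > 1"
  shows "AE \<omega> in M. \<forall>\<^sub>F n in sequentially. S n \<omega> < c * \<phi> n"
proof -
  define x where "x k = c * \<phi> (c ^ k)" for k :: nat
  define N where "N k = nat \<lfloor>c ^ Suc k\<rfloor>" for k
  define l where "l k = x k / (v * c ^ Suc k)" for k
  define A where "A k = {\<omega>\<in>space M. \<exists>n\<le>N k. S n \<omega> \<ge> x k}" for k
  have [measurable]: "A k \<in> sets M" for k unfolding A_def by measurable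
  have ln_c: "ln c > 0" using c by simp
  have l_lim: "l \<longlonglongrightarrow> 0"
  proof -
    have "(\<lambda>k. c * sqrt (2 * v * c ^ k * ln (k * ln c)) / (v * c ^ Suc k)) \<longlonglongrightarrow> 0"
      using c v_pos ln_c by real_asymp
    then show ?thesis using c
      by (simp add: l_def[abs_def] x_def \<phi>_def ln_realpow)
  qed
  \<comment> \<open>Any exponent strictly between 1 and \<open>c\<close> would do: above 1 for
    summability, below \<open>c\<close> to absorb the factor \<open>1 - l k\<close>, which tends to
    1.\<close>
  define d where "d = (c + 1) / 2"
  have d: "d > 1" "d < c" using c by (auto simp: d_def)
  have "1 - d / c > 0" using d c by simp
  with l_lim have "\<forall>\<^sub>F k in sequentially. l k < 1 - d / c"
    by (rule order_tendstoD)
  moreover have "\<forall>\<^sub>F k in sequentially. l k < 1"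
    using l_lim by (rule order_tendstoD) simp
  moreover have "\<forall>\<^sub>F k in sequentially. real k * ln c > 1"
    using ln_c by real_asymp
  ultimately have bound: "\<forall>\<^sub>F k in sequentially. norm (prob (A k)) \<le> (real k * ln c) powr (- d)"
  proof eventually_elim
    case (elim k)
    have "k > 0" using elim(3) by (cases k) auto
    have lnln: "ln (ln (c ^ k)) = ln (real k * ln c)" "ln (real k * ln c) > 0"
      using c elim by (auto simp: ln_realpow)
    have xsq: "(x k)\<^sup>2 = c\<^sup>2 * (2 * v * c ^ k * ln (real k * ln c))"
      using v_pos c lnln by (simp add: x_def \<phi>_def power_mult_distrib)
    have x0: "x k \<ge> 0" using v_pos c lnln by (auto simp: x_def \<phi>_def intro!: mult_nonneg_nonneg)
    have l0: "l k \<ge> 0" using x0 v_pos c by (simp add: l_def)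
    have "\<psi> (l k) \<ge> 0" using l0 v_pos by (simp add: \<psi>_def)
    have "real (N k) \<le> c ^ Suc k"
      using c unfolding N_def by (intro of_nat_floor) auto
    then have "N k * \<psi> (l k) - l k * x k \<le> c ^ Suc k * \<psi> (l k) - l k * x k"
      using \<open>\<psi> (l k) \<ge> 0\<close> by (intro diff_right_mono mult_right_mono)
    \<comment> \<open>By the choice of \<open>l k\<close>, the quadratic part of
      \<open>c ^ Suc k * \<psi> (l k)\<close> is exactly half of \<open>l k * x k\<close>; the cubic
      correction leaves the factor \<open>1 - l k\<close>.\<close>
    also have "\<dots> = - ((x k)\<^sup>2 / (2 * v * c ^ Suc k)) * (1 - l k)"
    proof -
      have "v * c ^ Suc k > 0" using v_pos c by simp
      moreover have "x k = l k * (v * c ^ Suc k)"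
        using v_pos c by (simp add: l_def)
      ultimately show ?thesis unfolding \<psi>_def
        by (simp add: power2_eq_square divide_simps) (simp add: algebra_simps)?
    qed
    also have "(x k)\<^sup>2 / (2 * v * c ^ Suc k) = c * ln (real k * ln c)"
      unfolding xsq using v_pos c by (simp add: power2_eq_square)
    also have "- (c * ln (real k * ln c)) * (1 - l k) \<le> - d * ln (real k * ln c)"
    proof -
      have "d \<le> c * (1 - l k)" using elim(1) c by (simp add: field_simps)
      then have "d * ln (real k * ln c) \<le> (c * (1 - l k)) * ln (real k * ln c)"
        using lnln by (intro mult_right_mono) auto
      then show ?thesis by (simp add: algebra_simps)
    qed
    finally have "exp (N k * \<psi> (l k) - l k * x k) \<le> (real k * ln c) powr (- d)"
      using lnln \<open>k > 0\<close> by (subst powr_def) auto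
    moreover have "prob (A k) \<le> exp (N k * \<psi> (l k) - l k * x k)"
      unfolding A_def using l0 elim by (intro prob_max_S_ge) auto
    ultimately show ?case by simp
  qed
  have "summable (\<lambda>k. ln c powr (- d) * real k powr (- d))"
    using d by (intro summable_mult) (simp add: summable_real_powr_iff)
  then have "summable (\<lambda>k. (real k * ln c) powr (- d))"
    using ln_c by (simp add: powr_mult mult.commute)
  then have "summable (\<lambda>k. prob (A k))"
    using bound by (rule summable_comparison_test_ev[rotated])
  then have "AE \<omega> in M. \<forall>\<^sub>F k in sequentially. \<omega> \<in> space M - A k"
    by (intro borel_cantelli_AE1) (auto simp: emeasure_eq_measure)
  then show ?thesis
  proof eventually_elim
    case (elim \<omega>)
    then obtain K where K: "\<And>k. k \<ge> K \<Longrightarrow> \<omega> \<in> space M - A k"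
      by (auto simp: eventually_sequentially)
    \<comment> \<open>\<open>\<phi>_mono\<close> applies only from \<open>exp 1\<close> on, so the
      blocks have to start beyond it.\<close>
    obtain K' where K': "c ^ K' > exp 1"
      using real_arch_pow[OF c] by blast
    define K0 where "K0 = max K K'"
    have "c ^ K' \<le> c ^ K0" using c by (intro power_increasing) (auto simp: K0_def)
    have "S n \<omega> < c * \<phi> n" if "n \<ge> nat \<lceil>c ^ K0\<rceil>" for n
    proof -
      have n: "real n \<ge> c ^ K0" using that by (simp add: nat_le_iff ceiling_le_iff)
      have n0: "real n > 0" using n c by (smt (verit) zero_less_power)
      define k where "k = nat \<lfloor>log c n\<rfloor>"
      have "real K0 \<le> log c n"
        using n c n0 by (subst le_log_iff) (auto simp: powr_realpow)
      then have k: "k \<ge> K0" "real k \<le> log c n" "log c n < real (Suc k)"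
        unfolding k_def by (auto simp: le_nat_floor) linarith+
      have k1: "c ^ k \<le> n" using k(2) c n0 by (subst (asm) le_log_iff) (auto simp: powr_realpow)
      have k2: "n < c ^ Suc k" using k(3) c n0 powr_realpow[of c "Suc k"] by (subst (asm) log_less_iff) auto
      have "n \<le> N k" using k2 unfolding N_def by (simp add: le_nat_floor)
      moreover have "\<omega> \<in> space M - A k" using k(1) K[of k] by (simp add: K0_def)
      ultimately have "\<not> S n \<omega> \<ge> x k" by (auto simp: A_def)
      then have "S n \<omega> < x k" by simp
      also have "x k \<le> c * \<phi> n" unfolding x_def
      proof (intro mult_left_mono \<phi>_mono k1)
        have "c ^ K0 \<le> c ^ k" using c k(1) by (intro power_increasing) auto
        then show "exp 1 \<le> c ^ k" using K' \<open>c ^ K' \<le> c ^ K0\<close> by linarith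
      qed (use c in auto)
      finally show ?thesis .
    qed
    then show ?case unfolding eventually_sequentially by blast
  qed
qed

end

section \<open>The lower half of the law of the iterated logarithm\<close>

text \<open>The tail is at least the density at \<open>t + 1\<close> times the length of the
  interval from \<open>t\<close> to \<open>t + 1\<close>. Compared with the target, the exponent
  loses only a term linear in \<open>t\<close> and a constant, which
  \<open>e * t\<^sup>2 / 2\<close> absorbs once \<open>t\<close> is large.\<close>

lemma std_normal_tail_gt:
  assumes "e > 0"
  obtains t where "t > 0" "measure std_normal_distribution {t<..} > exp (- (1 + e) * t\<^sup>2 / 2)"
proof -
  have "\<forall>\<^sub>F t in at_top. e * t\<^sup>2 / 2 - t - 1 / 2 - ln (sqrt (2 * pi)) > 0"
    using assms by real_asymp
  then have "\<forall>\<^sub>F t in at_top. exp (- (1 + e) * t\<^sup>2 / 2) < exp (- (t + 1)\<^sup>2 / 2) / sqrt (2 * pi)"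
  proof eventually_elim
    case (elim t)
    then have "exp (- (1 + e) * t\<^sup>2 / 2) < exp (- (t + 1)\<^sup>2 / 2 - ln (sqrt (2 * pi)))"
      by (simp add: power2_eq_square field_simps)
    also have "\<dots> = exp (- (t + 1)\<^sup>2 / 2) / sqrt (2 * pi)"
      by (simp add: exp_diff)
    finally show ?case .
  qed
  then have "\<forall>\<^sub>F t in at_top. t > 0 \<and> exp (- (1 + e) * t\<^sup>2 / 2) < exp (- (t + 1)\<^sup>2 / 2) / sqrt (2 * pi)"
    using eventually_gt_at_top[of "0::real"] by eventually_elim simp
  then obtain t :: real where t: "t > 0" "exp (- (1 + e) * t\<^sup>2 / 2) < exp (- (t + 1)\<^sup>2 / 2) / sqrt (2 * pi)"
    using eventually_happens'[OF trivial_limit_at_top_linorder] by blast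
  interpret N: real_distribution std_normal_distribution by (rule real_dist_normal_dist)
  define q where "q = exp (- (t + 1)\<^sup>2 / 2) / sqrt (2 * pi)"
  have q0: "q \<ge> 0" by (simp add: q_def)
  have "ennreal q = ennreal q * emeasure lborel {t<..t+1}"
    by simp
  also have "\<dots> = (\<integral>\<^sup>+x. ennreal q * indicator {t<..t+1} x \<partial>lborel)"
    by (subst nn_integral_cmult_indicator) auto
  also have "\<dots> \<le> (\<integral>\<^sup>+x. ennreal (std_normal_density x) * indicator {t<..} x \<partial>lborel)"
  proof (rule nn_integral_mono)
    fix x :: real
    have "q \<le> std_normal_density x" if "t < x" "x \<le> t + 1"
    proof -
      have "x\<^sup>2 \<le> (t + 1)\<^sup>2" using that t by (intro power_mono) auto
      then show ?thesis unfolding q_def std_normal_density_def by (simp add: divide_simps)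
    qed
    then show "ennreal q * indicator {t<..t+1} x \<le> ennreal (std_normal_density x) * indicator {t<..} x"
      by (auto simp: indicator_def intro!: ennreal_leI)
  qed
  also have "\<dots> = emeasure std_normal_distribution {t<..}"
    by (subst emeasure_density) auto
  also have "\<dots> = ennreal (measure std_normal_distribution {t<..})"
    by (rule N.emeasure_eq_measure)
  finally have "q \<le> measure std_normal_distribution {t<..}"
    by (simp add: ennreal_le_iff)
  then show ?thesis using t that unfolding q_def by force
qed

section \<open>Independent pieces of the walk and their Gaussian limit\<close>

context centered_iid begin

text \<open>All steps have the same law, so the characteristic function of a block sum is a power
  determined by the length of the block, and Levy's uniqueness theorem identifies the laws.\<close>

lemma prob_block_gt: "prob {\<omega>\<in>space M. (\<Sum>i\<in>{a..<a+m}. Y i \<omega>) > z} = prob {\<omega>\<in>space M. S m \<omega> > z}"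
proof -
  have ch: "char (distr M borel (\<lambda>\<omega>. \<Sum>i\<in>A. Y i \<omega>)) t = char (distr M borel (Y 0)) t ^ card A" for A t
  proof -
    have "char (distr M borel (\<lambda>\<omega>. \<Sum>i\<in>A. Y i \<omega>)) t = (\<Prod>i\<in>A. char (distr M borel (Y i)) t)"
      by (intro char_distr_sum indep_vars_subset[OF indep]) auto
    also have "\<dots> = (\<Prod>i\<in>A. char (distr M borel (Y 0)) t)"
      by (intro prod.cong refl arg_cong[where f = "\<lambda>D. char D t"] identical)
    finally show ?thesis by simp
  qed
  have "distr M borel (\<lambda>\<omega>. \<Sum>i\<in>{a..<a+m}. Y i \<omega>) = distr M borel (\<lambda>\<omega>. \<Sum>i\<in>{..<m}. Y i \<omega>)"
    by (intro Levy_uniqueness real_distribution_distr ext) (auto simp: ch)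
  then have "measure (distr M borel (\<lambda>\<omega>. \<Sum>i\<in>{a..<a+m}. Y i \<omega>)) {z<..}
     = measure (distr M borel (\<lambda>\<omega>. \<Sum>i\<in>{..<m}. Y i \<omega>)) {z<..}" by simp
  then show ?thesis
    by (subst (asm) (1 2) measure_distr) (auto simp: S_def vimage_def Int_def conj_commute)
qed

lemma prob_blocks_gt:
  "prob {\<omega>\<in>space M. \<forall>i<K. (\<Sum>j\<in>{a+i*m..<a+i*m+m}. Y j \<omega>) > z} = prob {\<omega>\<in>space M. S m \<omega> > z} ^ K"
\<comment> \<open>For no blocks the event is the whole space, whereas an intersection over an empty
  index set is \<open>UNIV\<close>.\<close>
proof (cases "K = 0")
  case True
  then show ?thesis by (simp add: prob_space)
next
  case False
  define J where "J i = {a+i*m..<a+i*m+m}" for i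
  have disj: "disjoint_family_on J {..<K}"
  proof -
    have "J i \<inter> J i' = {}" if "i < i'" for i i'
    proof -
      have "Suc i * m \<le> i' * m" using that by (intro mult_right_mono) auto
      then show ?thesis by (auto simp: J_def)
    qed
    then show ?thesis unfolding disjoint_family_on_def by (metis Int_commute linorder_neqE_nat)
  qed
  have ind: "indep_vars (\<lambda>_. borel) (\<lambda>i \<omega>. (\<Sum>j\<in>J i. restrict (\<lambda>j. Y j \<omega>) (J i) j)) {..<K}"
    by (rule indep_vars_compose2[OF indep_vars_restrict[OF indep _ disj]]) auto
  have "{\<omega>\<in>space M. \<forall>i<K. (\<Sum>j\<in>J i. Y j \<omega>) > z}
      = (\<Inter>i\<in>{..<K}. (\<lambda>\<omega>. (\<Sum>j\<in>J i. restrict (\<lambda>j. Y j \<omega>) (J i) j)) -` {z<..} \<inter> space M)"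
    using False by auto
  also have "prob \<dots> = (\<Prod>i\<in>{..<K}. prob ((\<lambda>\<omega>. (\<Sum>j\<in>J i. restrict (\<lambda>j. Y j \<omega>) (J i) j)) -` {z<..} \<inter> space M))"
    using False by (intro indep_varsD[OF ind]) auto
  also have "\<dots> = (\<Prod>i\<in>{..<K}. prob {\<omega>\<in>space M. S m \<omega> > z})"
  proof (rule prod.cong[OF refl])
    fix i
    have "(\<lambda>\<omega>. (\<Sum>j\<in>J i. restrict (\<lambda>j. Y j \<omega>) (J i) j)) -` {z<..} \<inter> space M
       = {\<omega>\<in>space M. (\<Sum>j\<in>J i. Y j \<omega>) > z}"
      by auto
    then show "prob ((\<lambda>\<omega>. (\<Sum>j\<in>J i. restrict (\<lambda>j. Y j \<omega>) (J i) j)) -` {z<..} \<inter> space M) = prob {\<omega>\<in>space M. S m \<omega> > z}"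
      unfolding J_def by (simp only: prob_block_gt)
  qed
  finally show ?thesis unfolding J_def by simp
qed

text \<open>The normal law has no atom, so weak convergence yields convergence of the distribution
  function at \<open>t\<close> itself; the strict assumption survives for large
  \<open>m\<close>.\<close>

lemma CLT_tail:
  assumes "measure std_normal_distribution {t<..} > q"
  shows "\<forall>\<^sub>F m in sequentially. prob {\<omega>\<in>space M. S m \<omega> > t * sqrt (v * m)} > q"
proof -
  interpret N: real_distribution std_normal_distribution by (rule real_dist_normal_dist)
  have conv: "weak_conv_m (\<lambda>n. distr M borel (\<lambda>x. (\<Sum>i<n. Y i x) / sqrt (n * (sqrt v)\<^sup>2))) std_normal_distribution"
  proof (rule central_limit_theorem_zero_mean)
    show "distr M borel (Y n) = distr M borel (Y 0)" for n by (rule identical)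
  qed (use v_pos indep in \<open>auto simp: mean second_moment\<close>)
  have "emeasure std_normal_distribution {t} = 0"
    by (subst emeasure_density) (auto simp: nn_integral_indicator_singleton)
  then have "measure std_normal_distribution {t} = 0" by (simp add: measure_def)
  then have "isCont (cdf std_normal_distribution) t"
    using N.isCont_cdf by simp
  with conv have "(\<lambda>n. cdf (distr M borel (\<lambda>x. (\<Sum>i<n. Y i x) / sqrt (n * (sqrt v)\<^sup>2))) t)
      \<longlonglongrightarrow> cdf std_normal_distribution t"
    by (simp add: weak_conv_m_def weak_conv_def)
  moreover have "cdf std_normal_distribution t < 1 - q"
  proof -
    have "{t<..} = space std_normal_distribution - {..t}" by auto
    then show ?thesis using assms N.prob_compl[of "{..t}"] by (simp add: cdf_def)
  qed
  ultimately have "\<forall>\<^sub>F n in sequentially. cdf (distr M borel (\<lambda>x. (\<Sum>i<n. Y i x) / sqrt (n * (sqrt v)\<^sup>2))) t < 1 - q"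
    by (rule order_tendstoD)
  then show ?thesis using eventually_gt_at_top[of 0]
  proof eventually_elim
    case (elim n)
    have "{\<omega>\<in>space M. S n \<omega> > t * sqrt (v * n)} = space M - (\<lambda>x. (\<Sum>i<n. Y i x) / sqrt (n * (sqrt v)\<^sup>2)) -` {..t} \<inter> space M"
      using elim v_pos by (auto simp: S_def field_simps not_le)
    then have "prob {\<omega>\<in>space M. S n \<omega> > t * sqrt (v * n)}
       = 1 - prob ((\<lambda>x. (\<Sum>i<n. Y i x) / sqrt (n * (sqrt v)\<^sup>2)) -` {..t} \<inter> space M)"
      by (simp add: Diff_Int_distrib2 prob_compl Int_absorb2)
    also have "\<dots> = 1 - cdf (distr M borel (\<lambda>x. (\<Sum>i<n. Y i x) / sqrt (n * (sqrt v)\<^sup>2))) t"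
      by (simp add: cdf_def measure_distr)
    finally show ?case using elim by simp
  qed
qed

end

section \<open>Almost sure lower bound along blocks of divergent total probability\<close>

context centered_iid begin

lemma \<phi>_nonneg: "exp 1 \<le> x \<Longrightarrow> 0 \<le> \<phi> x"
  using \<phi>_mono[of "exp 1" x] by (simp add: \<phi>_def)

lemma centered_iid_uminus: "centered_iid M (\<lambda>n \<omega>. - Y n \<omega>) v"
proof unfold_locales
  show "indep_vars (\<lambda>_. borel) (\<lambda>n \<omega>. - Y n \<omega>) UNIV"
    by (rule indep_vars_compose2[OF indep, of "\<lambda>_. uminus"]) simp
  show "distr M borel (\<lambda>\<omega>. - Y n \<omega>) = distr M borel (\<lambda>\<omega>. - Y 0 \<omega>)" for n
  proof -
    have *: "distr M borel (\<lambda>\<omega>. - Y i \<omega>) = distr (distr M borel (Y i)) borel uminus" for i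
      by (subst distr_distr) (simp_all add: comp_def)
    show ?thesis unfolding *[of n] *[of 0] identical[of n] ..
  qed
qed (simp_all add: bdd v_pos mean second_moment)

lemma S_uminus: "centered_iid.S (\<lambda>n \<omega>. - Y n \<omega>) n \<omega> = - S n \<omega>"
  unfolding centered_iid.S_def[OF centered_iid_uminus] S_def by (simp add: sum_negf)

text \<open>Any constant above 1 in place of 2 would follow in the same way. In
  \<open>S_lower\<close> this limits how negative the walk can be at the start of a block.\<close>

lemma S_lower_crude: "AE \<omega> in M. \<forall>\<^sub>F n in sequentially. S n \<omega> > - 2 * \<phi> n"
proof -
  have "AE \<omega> in M. \<forall>\<^sub>F n in sequentially. - S n \<omega> < 2 * \<phi> n"
    using centered_iid.S_upper[OF centered_iid_uminus, of 2] unfolding S_uminus by simp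
  then show ?thesis
    by eventually_elim (auto elim!: eventually_mono)
qed

text \<open>A block of length about \<open>\<theta> ^ Suc k\<close> is cut into
  \<open>K k \<approx> 2 (1 - e) ln (ln (\<theta> ^ Suc k)) / t\<^sup>2\<close> pieces, each of which is asked to exceed
  \<open>t\<close> standard deviations. As \<open>t\<close> is fixed, the central limit theorem alone bounds the probability
  of each piece, and the \<open>K k\<close>-th power of a Gaussian tail at \<open>t\<close> is of the order of the Gaussian
  tail at \<open>t * sqrt (K k)\<close>.\<close>

lemma S_lower:
  assumes d: "d > 0"
  shows "AE \<omega> in M. \<exists>\<^sub>F n in sequentially. S n \<omega> \<ge> (1 - d) * \<phi> n"
proof -
  \<comment> \<open>The gain over a block will cost \<open>2 * e\<close> and the position at its
    start another \<open>e\<close>. The cap keeps \<open>1 - 3 * e\<close> nonnegative.\<close>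
  define e where "e = min (d / 3) (1 / 3)"
  have e: "0 < e" "e \<le> 1 / 3" "3 * e \<le> d" using d by (auto simp: e_def)
  obtain t where t: "t > 0" "measure std_normal_distribution {t<..} > exp (- (1 + e) * t\<^sup>2 / 2)"
    using std_normal_tail_gt[OF e(1)] by blast
  \<comment> \<open>With at most \<open>c * L k\<close> pieces, each of probability at least
    \<open>exp (- (1 + e) * t\<^sup>2 / 2)\<close>, the product is at least
    \<open>exp (- (1 - e) * (1 + e) * L k)\<close>, hence at least \<open>exp (- L k)\<close>: a
    constant multiple of the harmonic series.\<close>
  define c where "c = 2 * (1 - e) / t\<^sup>2"
  have c: "c > 0" using e t by (simp add: c_def)
  \<comment> \<open>The bound \<open>4 / e\<^sup>2\<close> makes twice the envelope at the start of
    a block at most \<open>e\<close> times the envelope at its end. It also gives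
    \<open>1 < e * real \<theta>\<close>, so that the block fills a proportion above
    \<open>1 - e\<close> of the time up to its end.\<close>
  obtain \<theta> :: nat where \<theta>: "real \<theta> > max 2 (4 / e\<^sup>2)" using reals_Archimedean2 by blast
  have \<theta>2: "real \<theta> > 2" "\<theta> > 2" "\<theta> > 0" using \<theta> by auto
  have \<theta>e: "4 < e\<^sup>2 * \<theta>" using \<theta> e by (auto simp: field_simps)
  have ln\<theta>: "ln (real \<theta>) > 0" using \<theta>2 by simp
  \<comment> \<open>This is the iterated logarithm of \<open>\<theta> ^ Suc k\<close>, in a form
    whose exponential is visibly linear in \<open>Suc k\<close>.\<close>
  define L where "L k = ln (real (Suc k) * ln (real \<theta>))" for k
  define K where "K k = nat \<lfloor>c * L k\<rfloor>" for k
  define N where "N k = \<theta> ^ Suc k - \<theta> ^ k" for k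
  define m where "m k = N k div K k" for k
  define z where "z k = t * sqrt (v * m k)" for k
  define J where "J k = {\<theta> ^ k..<\<theta> ^ Suc k}" for k
  define D where "D k i = {\<theta> ^ k + i * m k..<\<theta> ^ k + i * m k + m k}" for k i
  \<comment> \<open>The whole path inside a block is one random variable; the paths over disjoint
    blocks are independent, as the second Borel-Cantelli lemma requires.\<close>
  define X where "X k \<omega> = restrict (\<lambda>i. Y i \<omega>) (J k)" for k \<omega>
  define G where "G k = {g\<in>space (PiM (J k) (\<lambda>_. borel)). \<forall>i\<in>{..<K k}. z k < (\<Sum>j\<in>D k i. g j :: real)}" for k

  have pow_le: "\<theta> ^ k \<le> \<theta> ^ Suc k" for k using \<theta>2 by simp
  have realN: "real (N k) = real \<theta> ^ k * (real \<theta> - 1)" for k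
    unfolding N_def using pow_le[of k] by (simp add: of_nat_diff algebra_simps)
  have Km: "K k * m k \<le> N k" for k by (simp add: m_def)
  have DJ: "D k i \<subseteq> J k" if "i < K k" for i k
  proof -
    have "Suc i * m k \<le> K k * m k" using that by (intro mult_right_mono) auto
    then have "\<theta> ^ k + i * m k + m k \<le> \<theta> ^ k + N k" using Km[of k] by simp
    also have "\<dots> = \<theta> ^ Suc k" using pow_le[of k] by (simp add: N_def)
    finally show ?thesis by (auto simp: D_def J_def)
  qed
  have disj: "disjoint_family J"
  proof -
    have "J k \<inter> J k' = {}" if "k < k'" for k k'
    proof -
      have "\<theta> ^ Suc k \<le> \<theta> ^ k'" using that \<theta>2 by (intro power_increasing) auto
      then show ?thesis by (auto simp: J_def)
    qed
    then show ?thesis unfolding disjoint_family_on_def by (metis Int_commute linorder_neqE_nat)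
  qed
  have indX: "indep_vars (\<lambda>k. PiM (J k) (\<lambda>_. borel)) X UNIV"
    unfolding X_def[abs_def] by (rule indep_vars_restrict[OF indep _ disj]) auto
  have G_sets: "G k \<in> sets (PiM (J k) (\<lambda>_. borel))" for k
  proof -
    have "(\<lambda>g. \<Sum>j\<in>D k i. g j :: real) \<in> borel_measurable (PiM (J k) (\<lambda>_. borel))" if "i \<in> {..<K k}" for i
      using that DJ by (intro borel_measurable_sum measurable_component_singleton) auto
    then have "Measurable.pred (PiM (J k) (\<lambda>_. borel)) (\<lambda>g. \<forall>i\<in>{..<K k}. z k < (\<Sum>j\<in>D k i. g j :: real))"
      by (intro pred_intros_finite) (auto intro!: borel_measurable_less simp: Measurable.pred_def)
    then show ?thesis unfolding G_def Measurable.pred_def .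
  qed
  have XG: "X k \<omega> \<in> G k \<longleftrightarrow> (\<forall>i<K k. z k < (\<Sum>j\<in>D k i. Y j \<omega>))" for k \<omega>
  proof -
    have "(\<Sum>j\<in>D k i. X k \<omega> j) = (\<Sum>j\<in>D k i. Y j \<omega>)" if "i < K k" for i
      using DJ[OF that] unfolding X_def by (intro sum.cong) auto
    moreover have "X k \<omega> \<in> space (PiM (J k) (\<lambda>_. borel))" by (simp add: X_def space_PiM)
    ultimately show ?thesis by (auto simp: G_def)
  qed
  have probG: "prob {\<omega>\<in>space M. X k \<omega> \<in> G k} = prob {\<omega>\<in>space M. S (m k) \<omega> > z k} ^ K k" for k
    unfolding XG D_def by (rule prob_blocks_gt)

  have K_le: "real (K k) \<le> c * L k" if "L k > 0" for k
    unfolding K_def using that c by (intro of_nat_floor) auto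
  have K_ge: "real (K k) \<ge> c * L k - 1" for k
    unfolding K_def by linarith
  have L_lim: "filterlim L at_top sequentially"
    unfolding L_def using ln\<theta> by real_asymp
  have ev_L: "\<forall>\<^sub>F k in sequentially. L k > max 1 (2 / c)"
    using L_lim unfolding filterlim_at_top_dense by blast
  have ev_K: "K k \<ge> 1" if "L k > max 1 (2 / c)" for k
  proof -
    have "c * L k > 2" using that c by (simp add: field_simps)
    then show ?thesis using K_ge[of k] by simp
  qed
  have m_ge: "real (K k) * real (m k) \<ge> real (N k) - real (K k)" if "K k \<ge> 1" for k
  proof -
    have "N k = K k * m k + N k mod K k" by (simp add: m_def)
    moreover have "N k mod K k < K k" using that by simp
    ultimately have "N k \<le> K k * m k + K k" by linarith
    then show ?thesis by (metis diff_le_eq of_nat_add of_nat_le_iff of_nat_mult)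
  qed
  \<comment> \<open>The central limit theorem needs long pieces: block lengths grow geometrically in
    \<open>k\<close>, the number of pieces only like \<open>ln k\<close>.\<close>
  have m_lim: "filterlim m at_top sequentially"
  proof -
    have "filterlim (\<lambda>k. real \<theta> ^ k * (real \<theta> - 1) / (c * L k) - 1) at_top sequentially"
      unfolding L_def using ln\<theta> \<theta>2 c by real_asymp
    moreover have "\<forall>\<^sub>F k in sequentially. real \<theta> ^ k * (real \<theta> - 1) / (c * L k) - 1 \<le> real (m k)"
      using ev_L
    proof eventually_elim
      case (elim k)
      have "real (N k) / (c * L k) \<le> real (N k) / real (K k)"
        using K_le[of k] ev_K[OF elim] elim by (intro divide_left_mono) auto
      also have "\<dots> \<le> real (m k) + 1"
        using m_ge[OF ev_K[OF elim]] ev_K[OF elim] by (simp add: field_simps)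
      finally show ?case by (simp add: realN)
    qed
    ultimately have "filterlim (\<lambda>k. real (m k)) at_top sequentially"
      by (rule filterlim_at_top_mono)
    then show ?thesis by (simp add: filterlim_real_sequentially filterlim_sequentially_iff_filterlim_real)
  qed
  have "\<forall>\<^sub>F k in sequentially. prob {\<omega>\<in>space M. S (m k) \<omega> > z k} > exp (- (1 + e) * t\<^sup>2 / 2)"
    unfolding z_def using eventually_compose_filterlim[OF CLT_tail[OF t(2)] m_lim] .
  with ev_L have ev_prob: "\<forall>\<^sub>F k in sequentially. norm (1 / ln (real \<theta>) * inverse (real (Suc k))) \<le> prob {\<omega>\<in>space M. X k \<omega> \<in> G k}"
  proof eventually_elim
    case (elim k)
    have "exp (L k) = real (Suc k) * ln (real \<theta>)"
      unfolding L_def using ln\<theta> by (intro exp_ln mult_pos_pos) auto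
    then have "1 / ln (real \<theta>) * inverse (real (Suc k)) = exp (- L k)"
      by (simp add: exp_minus divide_inverse mult.commute del: of_nat_Suc)
    also have "- L k \<le> - (1 - e) * (1 + e) * L k"
    proof -
      have "(1 - e) * (1 + e) \<le> 1" by (simp add: algebra_simps)
      then have "((1 - e) * (1 + e)) * L k \<le> 1 * L k" using elim by (intro mult_right_mono) auto
      then show ?thesis by (simp add: algebra_simps)
    qed
    also have "\<dots> = - ((1 + e) * t\<^sup>2 / 2 * (c * L k))"
      using t by (simp add: c_def field_simps)
    also have "\<dots> \<le> - ((1 + e) * t\<^sup>2 / 2 * K k)"
      using K_le[of k] elim e by (intro le_imp_neg_le mult_left_mono) auto
    also have "exp \<dots> = exp (- (1 + e) * t\<^sup>2 / 2) ^ K k"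
      by (subst exp_of_nat_mult[symmetric]) (simp add: field_simps)
    also have "\<dots> \<le> prob {\<omega>\<in>space M. S (m k) \<omega> > z k} ^ K k"
      using elim by (intro power_mono) auto
    finally show ?case unfolding probG using ln\<theta> by simp
  qed
  have "\<not> summable (\<lambda>k. prob {\<omega>\<in>space M. X k \<omega> \<in> G k})"
  proof
    assume "summable (\<lambda>k. prob {\<omega>\<in>space M. X k \<omega> \<in> G k})"
    with ev_prob have "summable (\<lambda>k. 1 / ln (real \<theta>) * inverse (real (Suc k)))"
      by (rule summable_comparison_test_ev)
    then have "summable (\<lambda>k. inverse (real (Suc k)))"
      by (rule summable_mult_D) (use ln\<theta> in simp)
    then have "summable (\<lambda>n. inverse (real n))"
      by (subst (asm) summable_Suc_iff)
    then show False
      using not_summable_harmonic[where 'a = real] by simp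
  qed
  from borel_cantelli_2_AE[OF indX G_sets this]
  have "AE \<omega> in M. \<exists>\<^sub>F k in sequentially. \<forall>i<K k. z k < (\<Sum>j\<in>D k i. Y j \<omega>)"
    unfolding XG .

  \<comment> \<open>A lower bound for \<open>(K k * z k)\<^sup>2\<close> divided by the square of
    the envelope at \<open>\<theta> ^ Suc k\<close>; \<open>v\<close> cancels, and the losses from
    rounding \<open>K k\<close> and \<open>m k\<close> appear as \<open>- 1\<close> and
    \<open>- c * L k\<close>. The limit is \<open>(1 - e) * ((\<theta> - 1) / \<theta>)\<close>,
    which exceeds \<open>(1 - e)\<^sup>2\<close>.\<close>
  have "(\<lambda>k. (t\<^sup>2 * (c * L k - 1) / (2 * L k)) * ((real \<theta> ^ k * (real \<theta> - 1) - c * L k) / real \<theta> ^ Suc k))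
      \<longlonglongrightarrow> (t\<^sup>2 * c / 2) * ((real \<theta> - 1) / real \<theta>)"
  proof (rule tendsto_mult)
    show "(\<lambda>k. t\<^sup>2 * (c * L k - 1) / (2 * L k)) \<longlonglongrightarrow> t\<^sup>2 * c / 2"
      unfolding L_def using ln\<theta> by real_asymp
    show "(\<lambda>k. (real \<theta> ^ k * (real \<theta> - 1) - c * L k) / real \<theta> ^ Suc k) \<longlonglongrightarrow> (real \<theta> - 1) / real \<theta>"
      unfolding L_def using ln\<theta> \<theta>2 by real_asymp (use \<theta>2 in \<open>simp add: divide_inverse\<close>)
  qed
  moreover have "(1 - 2 * e)\<^sup>2 < (t\<^sup>2 * c / 2) * ((real \<theta> - 1) / real \<theta>)"
  proof -
    have "1 < e * real \<theta>"
    proof -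
      have "e\<^sup>2 * \<theta> \<le> e * \<theta>" using e \<theta>2 by (intro mult_right_mono) (auto simp: power2_eq_square)
      then show ?thesis using \<theta>e by simp
    qed
    then have "1 - e < (real \<theta> - 1) / real \<theta>" using \<theta>2 by (simp add: field_simps)
    then have "(1 - e) * (1 - e) < (1 - e) * ((real \<theta> - 1) / real \<theta>)"
      using e by (intro mult_strict_left_mono) auto
    moreover have tc: "t\<^sup>2 * c / 2 = 1 - e" using t by (simp add: c_def)
    moreover have "(1 - 2 * e)\<^sup>2 \<le> (1 - e) * (1 - e)"
      unfolding power2_eq_square using e by (intro mult_mono) auto
    ultimately show ?thesis unfolding tc by linarith
  qed
  ultimately have "\<forall>\<^sub>F k in sequentially. (1 - 2 * e)\<^sup>2 <
      (t\<^sup>2 * (c * L k - 1) / (2 * L k)) * ((real \<theta> ^ k * (real \<theta> - 1) - c * L k) / real \<theta> ^ Suc k)"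
    by (rule order_tendstoD)
  moreover have "\<forall>\<^sub>F k in sequentially. real \<theta> ^ k * (real \<theta> - 1) > c * L k"
    unfolding L_def using ln\<theta> \<theta>2 by real_asymp
  ultimately have ev_sum: "\<forall>\<^sub>F k in sequentially. (1 - 2 * e) * \<phi> (real \<theta> ^ Suc k) \<le> K k * z k"
    using ev_L
  proof eventually_elim
    case (elim k)
    have \<phi>: "\<phi> (real \<theta> ^ Suc k) = sqrt (2 * v * real \<theta> ^ Suc k * L k)"
      using \<theta>2 by (simp only: \<phi>_def L_def ln_realpow)
    have cL: "c * L k > 2" using elim c by (simp add: field_simps)
    have Kk: "real (K k) * real (m k) \<ge> real \<theta> ^ k * (real \<theta> - 1) - c * L k"
      using m_ge[OF ev_K[OF elim(3)]] K_le[of k] elim by (simp add: realN)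
    have "((1 - 2 * e) * \<phi> (real \<theta> ^ Suc k))\<^sup>2 = v * ((1 - 2 * e)\<^sup>2 * (2 * L k * real \<theta> ^ Suc k))"
      unfolding \<phi> using v_pos elim by (simp add: power_mult_distrib)
    also have "(1 - 2 * e)\<^sup>2 * (2 * L k * real \<theta> ^ Suc k)
      \<le> t\<^sup>2 * (c * L k - 1) * (real \<theta> ^ k * (real \<theta> - 1) - c * L k)"
    proof -
      have "2 * L k * real \<theta> ^ Suc k > 0" using elim \<theta>2 by simp
      then have "(1 - 2 * e)\<^sup>2 * (2 * L k * real \<theta> ^ Suc k) \<le>
         ((t\<^sup>2 * (c * L k - 1) / (2 * L k)) * ((real \<theta> ^ k * (real \<theta> - 1) - c * L k) / real \<theta> ^ Suc k)) * (2 * L k * real \<theta> ^ Suc k)"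
        using elim(1) by (intro mult_right_mono) auto
      also have "\<dots> = t\<^sup>2 * (c * L k - 1) * (real \<theta> ^ k * (real \<theta> - 1) - c * L k)"
        using elim \<theta>2 by (simp del: power_Suc)
      finally show ?thesis .
    qed
    also have "\<dots> \<le> t\<^sup>2 * real (K k) * (real (K k) * real (m k))"
      using K_ge[of k] Kk elim cL t by (intro mult_mono) auto
    also have "v * \<dots> = (K k * z k)\<^sup>2"
      unfolding z_def using v_pos by (simp add: power_mult_distrib) (simp add: power2_eq_square)
    finally have "((1 - 2 * e) * \<phi> (real \<theta> ^ Suc k))\<^sup>2 \<le> (K k * z k)\<^sup>2"
      using v_pos by simp
    then show ?case
      by (rule power2_le_imp_le) (use t v_pos in \<open>simp add: z_def\<close>)
  qed
  have ev_prev: "\<forall>\<^sub>F k in sequentially. 2 * \<phi> (real \<theta> ^ k) \<le> e * \<phi> (real \<theta> ^ Suc k)"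
    using ev_L eventually_gt_at_top[of 0]
  proof eventually_elim
    case (elim k)
    have "ln (ln (real \<theta> ^ k)) \<le> L k"
    proof -
      have "ln (real \<theta> ^ k) = real k * ln \<theta>" using \<theta>2 by (simp add: ln_realpow)
      moreover have "\<dots> \<le> real (Suc k) * ln \<theta>" using ln\<theta> by (intro mult_right_mono) auto
      ultimately show ?thesis unfolding L_def using ln\<theta> elim by simp
    qed
    then have "4 * (2 * v * real \<theta> ^ k * ln (ln (real \<theta> ^ k))) \<le> 4 * (2 * v * real \<theta> ^ k * L k)"
      using v_pos by (intro mult_left_mono) auto
    also have "\<dots> \<le> (e\<^sup>2 * \<theta>) * (2 * v * real \<theta> ^ k * L k)"
      using \<theta>e v_pos elim by (intro mult_right_mono) auto
    finally have "4 * (2 * v * real \<theta> ^ k * ln (ln (real \<theta> ^ k))) \<le> (e\<^sup>2 * \<theta>) * (2 * v * real \<theta> ^ k * L k)" .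
    then have "sqrt (4 * (2 * v * real \<theta> ^ k * ln (ln (real \<theta> ^ k)))) \<le> sqrt (e\<^sup>2 * (2 * v * real \<theta> ^ Suc k * L k))"
      by (intro real_sqrt_le_mono) (simp add: mult_ac)
    then show ?case
      unfolding \<phi>_def L_def using e \<theta>2 by (simp only: real_sqrt_mult real_sqrt_four ln_realpow) simp
  qed
  show ?thesis
    using \<open>AE \<omega> in M. \<exists>\<^sub>F k in sequentially. \<forall>i<K k. z k < (\<Sum>j\<in>D k i. Y j \<omega>)\<close> S_lower_crude
  proof eventually_elim
    case (elim \<omega>)
    have pow_lim: "filterlim (\<lambda>k. \<theta> ^ k) at_top sequentially"
    proof -
      have "filterlim (\<lambda>k. real \<theta> ^ k) at_top sequentially" using \<theta>2 by real_asymp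
      then show ?thesis by (simp add: filterlim_sequentially_iff_filterlim_real)
    qed
    show ?case unfolding frequently_sequentially
    proof
      fix n0
      have "\<forall>\<^sub>F k in sequentially. S (\<theta> ^ k) \<omega> > - 2 * \<phi> (real (\<theta> ^ k))"
        using eventually_compose_filterlim[OF elim(2) pow_lim] .
      moreover have "\<forall>\<^sub>F k in sequentially. \<theta> ^ k \<ge> max n0 3"
        using pow_lim unfolding filterlim_at_top by blast
      ultimately have "\<forall>\<^sub>F k in sequentially. S (\<theta> ^ k) \<omega> > - 2 * \<phi> (real (\<theta> ^ k)) \<and> \<theta> ^ k \<ge> max n0 3
          \<and> 2 * \<phi> (real \<theta> ^ k) \<le> e * \<phi> (real \<theta> ^ Suc k) \<and> (1 - 2 * e) * \<phi> (real \<theta> ^ Suc k) \<le> K k * z k"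
        using ev_prev ev_sum by eventually_elim simp
      from frequently_eventually_conj[OF elim(1) this] obtain k where
        k: "\<forall>i<K k. z k < (\<Sum>j\<in>D k i. Y j \<omega>)" "S (\<theta> ^ k) \<omega> > - 2 * \<phi> (real \<theta> ^ k)" "\<theta> ^ k \<ge> max n0 3"
          "2 * \<phi> (real \<theta> ^ k) \<le> e * \<phi> (real \<theta> ^ Suc k)" "(1 - 2 * e) * \<phi> (real \<theta> ^ Suc k) \<le> K k * z k"
        by (auto dest: frequently_ex)
      \<comment> \<open>The witness is the end of the last piece: nothing is known about the
        remainder left by the division. Since \<open>p\<close> is at most
        \<open>\<theta> ^ Suc k\<close>, its envelope is no larger.\<close>
      define p where "p = \<theta> ^ k + K k * m k"
      have "S (\<theta> ^ k + i * m k) \<omega> \<ge> S (\<theta> ^ k) \<omega> + i * z k" if "i \<le> K k" for i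
        using that
      proof (induction i)
        case (Suc i)
        have "S (\<theta> ^ k + Suc i * m k) \<omega> = S (\<theta> ^ k + i * m k) \<omega> + (\<Sum>j\<in>D k i. Y j \<omega>)"
          unfolding S_def D_def lessThan_atLeast0 by (subst sum.atLeastLessThan_concat) (auto simp: ac_simps)
        moreover have "z k < (\<Sum>j\<in>D k i. Y j \<omega>)" using k(1) Suc by simp
        ultimately show ?case using Suc by (simp add: algebra_simps)
      qed simp
      from this[of "K k"] have "S p \<omega> \<ge> S (\<theta> ^ k) \<omega> + K k * z k" by (simp add: p_def)
      also have "S (\<theta> ^ k) \<omega> + K k * z k \<ge> (1 - 3 * e) * \<phi> (real \<theta> ^ Suc k)"
        using k by (simp add: algebra_simps)
      finally have Sp: "S p \<omega> \<ge> (1 - 3 * e) * \<phi> (real \<theta> ^ Suc k)" .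
      have "exp 1 \<le> (3::real)" by (rule exp_le)
      moreover have "3 \<le> p" "n0 \<le> p" using k(3) by (auto simp: p_def)
      ultimately have p: "exp 1 \<le> real p" "n0 \<le> p" by auto
      have "p \<le> \<theta> ^ Suc k" using Km[of k] pow_le[of k] unfolding p_def N_def by linarith
      then have "real p \<le> real \<theta> ^ Suc k" by (metis of_nat_le_iff of_nat_power)
      then have "\<phi> p \<le> \<phi> (real \<theta> ^ Suc k)" using p by (intro \<phi>_mono)
      then have "(1 - 3 * e) * \<phi> p \<le> (1 - 3 * e) * \<phi> (real \<theta> ^ Suc k)"
        using e by (intro mult_left_mono) auto
      then have "(1 - 3 * e) * \<phi> p \<le> S p \<omega>"
        using Sp by linarith
      moreover have "(1 - d) * \<phi> p \<le> (1 - 3 * e) * \<phi> p"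
        using e \<phi>_nonneg[OF p(1)] by (intro mult_right_mono) auto
      ultimately have "(1 - d) * \<phi> p \<le> S p \<omega>" by linarith
      then show "\<exists>n\<ge>n0. (1 - d) * \<phi> (real n) \<le> S n \<omega>" using p by blast
    qed
  qed
qed

end

section \<open>Balanced walks\<close>

text \<open>Both ends of the window are free because the policy will choose them. The steps range
  over an interval of length 2, so with the factor 4 Hoeffding's exponent is
  \<open>- 8 * ln n\<close>. A union bound over at most \<open>n * Suc n\<close> windows leaves
  \<open>4 * real n powr (- 6)\<close>, which is summable.\<close>

lemma (in prob_space) bounded_increments_AE:
  fixes X :: "nat \<Rightarrow> 'a \<Rightarrow> real"
  assumes indep: "indep_vars (\<lambda>_. borel) X UNIV"
    and bdd: "\<And>n \<omega>. \<omega> \<in> space M \<Longrightarrow> \<bar>X n \<omega>\<bar> \<le> 1"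
    and mean: "\<And>n. expectation (X n) = 0"
  shows "AE \<omega> in M. \<forall>\<^sub>F n in sequentially. \<forall>a b. a \<le> b \<longrightarrow> b \<le> n \<longrightarrow>
    \<bar>\<Sum>i\<in>{a..<b}. X i \<omega>\<bar> \<le> 4 * sqrt (real (b - a) * ln n)"
proof -
  have X[measurable]: "X n \<in> borel_measurable M" for n
    using indep by (auto simp: indep_vars_def)
  define E where "E n a b = {\<omega>\<in>space M. \<bar>\<Sum>i\<in>{a..<b}. X i \<omega>\<bar> \<ge> 4 * sqrt (real (b - a) * ln n)}" for n a b :: nat
  define A where "A n = (\<Union>(a, b)\<in>{(a, b). a < b \<and> b \<le> n}. E n a b)" for n
  have [measurable]: "E n a b \<in> sets M" for n a b unfolding E_def by measurable
  have sub: "{(a, b). a < b \<and> b \<le> n} \<subseteq> {..<n} \<times> {..n}" for n :: nat by auto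
  have fin: "finite {(a, b). a < b \<and> b \<le> n}" for n :: nat
    using sub by (rule finite_subset) simp
  have A[measurable]: "A n \<in> sets M" for n
    unfolding A_def using fin by (intro sets.finite_UN) auto
  have E_le: "prob (E n a b) \<le> 2 * real n powr (- 8)" if "a < b" "n \<ge> 1" for n a b
  proof -
    interpret Hoeffding_ineq M "{a..<b}" X "\<lambda>_. -1" "\<lambda>_. 1" 0
    proof unfold_locales
      show "AE \<omega> in M. X i \<omega> \<in> {- 1..1}" for i
        using bdd[of _ i] by (intro AE_I2) (auto simp: abs_le_iff minus_le_iff)
    qed (auto simp: mean intro: indep_vars_subset[OF indep])
    have pos: "0 \<le> real (b - a) * ln n" using that by simp
    have sum4: "(\<Sum>i\<in>{a..<b}. (1 - (- 1 :: real))\<^sup>2) = 4 * real (b - a)" by (simp add: algebra_simps)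
    have "prob (E n a b) \<le> 2 * exp (- 2 * (4 * sqrt (real (b - a) * ln n))\<^sup>2 / (\<Sum>i\<in>{a..<b}. (1 - (- 1 :: real))\<^sup>2))"
      unfolding E_def using Hoeffding_ineq_abs_ge[of "4 * sqrt (real (b - a) * ln n)"] pos that by simp
    also have "- 2 * (4 * sqrt (real (b - a) * ln n))\<^sup>2 / (\<Sum>i\<in>{a..<b}. (1 - (- 1 :: real))\<^sup>2) = - 8 * ln n"
    proof -
      define D where "D = real (b - a)"
      have "D > 0" "0 \<le> D * ln n" using that pos by (auto simp: D_def)
      then show ?thesis unfolding sum4 D_def[symmetric] by (simp add: power_mult_distrib)
    qed
    finally show ?thesis using that by (simp add: powr_def)
  qed
  have "prob (A n) \<le> 4 * real n powr (- 6)" if "n \<ge> 1" for n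
  proof -
    have "prob (A n) \<le> (\<Sum>ab\<in>{(a, b). a < b \<and> b \<le> n}. prob (case ab of (a, b) \<Rightarrow> E n a b))"
      unfolding A_def using fin by (intro finite_measure_subadditive_finite) auto
    also have "\<dots> \<le> (\<Sum>ab\<in>{(a, b). a < b \<and> b \<le> n}. 2 * real n powr (- 8))"
      using E_le that by (intro sum_mono) auto
    also have "\<dots> = real (card {(a, b). a < b \<and> b \<le> n}) * (2 * real n powr (- 8))"
      by simp
    also have "\<dots> \<le> real (n * Suc n) * (2 * real n powr (- 8))"
    proof (intro mult_right_mono of_nat_mono)
      show "card {(a, b). a < b \<and> b \<le> n} \<le> n * Suc n"
        using card_mono[OF _ sub[of n]] by (simp add: card_cartesian_product)
    qed auto
    also have "\<dots> \<le> (2 * real n ^ 2) * (2 * real n powr (- 8))"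
      using that by (intro mult_right_mono) (auto simp: power2_eq_square algebra_simps)
    also have "\<dots> = 4 * (real n powr 2 * real n powr (- 8))" using that by simp
    also have "\<dots> = 4 * real n powr (- 6)" by (subst powr_add[symmetric]) simp
    finally show ?thesis .
  qed
  then have "\<forall>\<^sub>F n in sequentially. norm (prob (A n)) \<le> 4 * real n powr (- 6)"
    by (auto simp: eventually_sequentially)
  moreover have "summable (\<lambda>n. 4 * real n powr (- 6))"
    by (intro summable_mult) (simp add: summable_real_powr_iff)
  ultimately have "summable (\<lambda>n. prob (A n))"
    by (rule summable_comparison_test_ev)
  then have "AE \<omega> in M. \<forall>\<^sub>F n in sequentially. \<omega> \<in> space M - A n"
    by (intro borel_cantelli_AE1) (auto simp: emeasure_eq_measure)
  then show ?thesis
  proof eventually_elim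
    case (elim \<omega>)
    then show ?case
    proof eventually_elim
      case (elim n)
      have "\<bar>\<Sum>i\<in>{a..<b}. X i \<omega>\<bar> \<le> 4 * sqrt (real (b - a) * ln n)" if "a \<le> b" "b \<le> n" for a b
      proof (cases "a = b")
        case False
        then have "\<omega> \<notin> E n a b" using elim that by (auto simp: A_def)
        then show ?thesis using elim by (auto simp: E_def)
      qed simp
      then show ?case by blast
    qed
  qed
qed

section \<open>Upper limits and normalizations along the halved index\<close>

lemma limsup_eq_1I:
  fixes a :: "nat \<Rightarrow> real"
  assumes "\<And>d. d > 0 \<Longrightarrow> \<forall>\<^sub>F n in sequentially. a n \<le> 1 + d"
    and "\<And>d. d > 0 \<Longrightarrow> \<exists>\<^sub>F n in sequentially. a n \<ge> 1 - d"
  shows "limsup (\<lambda>n. ereal (a n)) = 1"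
proof (rule antisym)
  show "limsup (\<lambda>n. ereal (a n)) \<le> 1"
  proof (rule ereal_le_epsilon2)
    fix d :: real assume "0 < d"
    then show "limsup (\<lambda>n. ereal (a n)) \<le> 1 + ereal d"
      using assms(1)[of d] by (intro Limsup_bounded) (auto simp: one_ereal_def elim!: eventually_mono)
  qed
  show "1 \<le> limsup (\<lambda>n. ereal (a n))"
  proof (rule ccontr)
    assume "\<not> 1 \<le> limsup (\<lambda>n. ereal (a n))"
    then have "limsup (\<lambda>n. ereal (a n)) < 1" by simp
    then obtain y where y: "limsup (\<lambda>n. ereal (a n)) < ereal y" "ereal y < 1"
      using ereal_dense2 by blast
    from Limsup_lessD[OF y(1)] have "\<forall>\<^sub>F n in sequentially. a n < y" by simp
    moreover have "\<exists>\<^sub>F n in sequentially. a n \<ge> 1 - (1 - y)"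
      using y by (intro assms(2)) (simp add: one_ereal_def)
    ultimately have "\<exists>\<^sub>F n in sequentially. a n < y \<and> a n \<ge> 1 - (1 - y)"
      by (rule frequently_eventually_conj[rotated])
    then show False by (auto dest: frequently_ex)
  qed
qed

lemma filterlim_half_nat: "filterlim (\<lambda>n::nat. n div 2) at_top sequentially"
  unfolding filterlim_at_top
proof
  fix Z :: nat
  show "\<forall>\<^sub>F n in sequentially. Z \<le> n div 2"
    using eventually_ge_at_top[of "2 * Z"] by eventually_elim simp
qed

text \<open>Halving is onto: a large value of \<open>b\<close> at \<open>k\<close> is seen by
  \<open>a\<close> at \<open>2 * k\<close>, so frequent events transfer as well as eventual
  ones.\<close>

lemma limsup_halved_eq_1:
  fixes a b :: "nat \<Rightarrow> real"
  assumes ub: "\<And>d. d > 0 \<Longrightarrow> \<forall>\<^sub>F k in sequentially. b k \<le> 1 + d"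
    and lb: "\<And>d. d > 0 \<Longrightarrow> \<exists>\<^sub>F k in sequentially. b k \<ge> 1 - d"
    and lim: "(\<lambda>n. a n - b (n div 2)) \<longlonglongrightarrow> 0"
  shows "limsup (\<lambda>n. ereal (a n)) = 1"
proof (rule limsup_eq_1I)
  fix d :: real assume d: "d > 0"
  have "\<forall>\<^sub>F n in sequentially. dist (a n - b (n div 2)) 0 < d / 2"
    using d by (intro tendstoD[OF lim]) simp
  then have close: "\<forall>\<^sub>F n in sequentially. \<bar>a n - b (n div 2)\<bar> < d / 2" by (simp add: dist_real_def)
  show "\<forall>\<^sub>F n in sequentially. a n \<le> 1 + d"
    using eventually_compose_filterlim[OF ub[OF half_gt_zero[OF d]] filterlim_half_nat] close
    by eventually_elim linarith
  show "\<exists>\<^sub>F n in sequentially. a n \<ge> 1 - d"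
    unfolding frequently_sequentially
  proof
    fix N :: nat
    obtain N' where N': "\<And>n. n \<ge> N' \<Longrightarrow> \<bar>a n - b (n div 2)\<bar> < d / 2"
      using close by (auto simp: eventually_sequentially)
    obtain k where k: "k \<ge> max N N'" "b k \<ge> 1 - d / 2"
      using lb[of "d / 2"] d unfolding frequently_sequentially by (meson half_gt_zero)
    have "\<bar>a (2 * k) - b k\<bar> < d / 2" using N'[of "2 * k"] k by simp
    then have "a (2 * k) \<ge> 1 - d" using k by linarith
    moreover have "2 * k \<ge> N" using k by simp
    ultimately show "\<exists>n\<ge>N. 1 - d \<le> a n" by blast
  qed
qed

lemma real_half_bounds: "(real n - 1) / 2 \<le> real (n div 2)" "real (n div 2) \<le> real n / 2"
  by (cases "even n"; auto elim!: evenE oddE)+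

text \<open>The factor 2 of the iterated logarithm law cancels against the halved time. The rounding
  in \<open>n div 2\<close> is handled by squeezing it between \<open>(n - 1) / 2\<close> and
  \<open>n / 2\<close>, where the monotone \<open>h\<close> has elementary asymptotics.\<close>

lemma LIL_normalization_halved:
  fixes v :: real
  assumes "v > 0"
  shows "(\<lambda>n. sqrt (2 * v * real (n div 2) * ln (ln (real (n div 2)))) / sqrt (v * real n * ln (ln (real n)))) \<longlonglongrightarrow> 1"
proof -
  define h where "h x = 2 * x * ln (ln x)" for x :: real
  have "(\<lambda>n. h (real (n div 2)) / (real n * ln (ln (real n)))) \<longlonglongrightarrow> 1"
  proof (rule real_tendsto_sandwich)
    have mono: "h x \<le> h y" if "exp 1 \<le> x" "x \<le> y" for x y
    proof -
      have e: "exp 1 > (1::real)" by simp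
      have x: "x > 1" "y > 1" using that e by linarith+
      have "ln x \<ge> 1" using that x by (subst ln_ge_iff) auto
      moreover have "ln x \<le> ln y" using that x by simp
      ultimately have "0 \<le> ln (ln x)" "ln (ln x) \<le> ln (ln y)" by auto
      then show ?thesis using x that unfolding h_def by (intro mult_mono) auto
    qed
    have big: "\<forall>\<^sub>F n in sequentially. real n > 10 \<and> ln (ln (real n)) > 0"
      by (intro eventually_conj) real_asymp+
    have e3: "exp 1 \<le> (3::real)" by (rule exp_le)
    show "\<forall>\<^sub>F n in sequentially. h ((real n - 1) / 2) / (real n * ln (ln (real n))) \<le> h (real (n div 2)) / (real n * ln (ln (real n)))"
      using big
    proof eventually_elim
      case (elim n)
      show ?case using elim e3 real_half_bounds[of n] by (intro divide_right_mono mono) auto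
    qed
    show "\<forall>\<^sub>F n in sequentially. h (real (n div 2)) / (real n * ln (ln (real n))) \<le> h (real n / 2) / (real n * ln (ln (real n)))"
      using big
    proof eventually_elim
      case (elim n)
      show ?case using elim e3 real_half_bounds[of n] by (intro divide_right_mono mono) auto
    qed
    show "(\<lambda>n. h ((real n - 1) / 2) / (real n * ln (ln (real n)))) \<longlonglongrightarrow> 1"
      unfolding h_def by real_asymp
    show "(\<lambda>n. h (real n / 2) / (real n * ln (ln (real n)))) \<longlonglongrightarrow> 1"
      unfolding h_def by real_asymp
  qed
  then have "(\<lambda>n. sqrt (h (real (n div 2)) / (real n * ln (ln (real n))))) \<longlonglongrightarrow> sqrt 1"
    by (rule tendsto_real_sqrt)
  moreover have "sqrt (h (real (n div 2)) / (real n * ln (ln (real n))))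
      = sqrt (2 * v * real (n div 2) * ln (ln (real (n div 2)))) / sqrt (v * real n * ln (ln (real n)))" for n
    using assms unfolding h_def by (simp add: real_sqrt_mult real_sqrt_divide)
  ultimately show ?thesis by simp
qed

text \<open>The two counters are balanced to within one unit, so \<open>2 * \<mu> * (R n - n / 2)\<close> is the
  centered walk \<open>W\<close> at time about \<open>n / 2\<close>; a first crude bound on \<open>R n - n / 2\<close> confines
  the error to increments over windows of length \<open>sqrt (n * ln n)\<close>.\<close>

lemma balanced_walks_close:
  fixes u w :: "nat \<Rightarrow> real" and R :: "nat \<Rightarrow> nat" and v \<mu> :: real
  defines "W \<equiv> (\<lambda>k. \<Sum>j<k. w j - u j)" and "\<phi> \<equiv> (\<lambda>k::nat. sqrt (2 * v * real k * ln (ln (real k))))"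
  assumes v: "v > 0" and \<mu>: "\<mu> > 0" and R: "\<And>n. R n \<le> n"
    and balanced: "\<And>n. \<bar>(\<mu> * real (n - R n) + (\<Sum>j<n - R n. w j)) - (\<mu> * real (R n) + (\<Sum>j<R n. u j))\<bar> \<le> 1"
    and incr_u: "\<forall>\<^sub>F n in sequentially. \<forall>a b. a \<le> b \<longrightarrow> b \<le> n \<longrightarrow> \<bar>\<Sum>i\<in>{a..<b}. u i\<bar> \<le> 4 * sqrt (real (b - a) * ln n)"
    and incr_w: "\<forall>\<^sub>F n in sequentially. \<forall>a b. a \<le> b \<longrightarrow> b \<le> n \<longrightarrow> \<bar>\<Sum>i\<in>{a..<b}. w i\<bar> \<le> 4 * sqrt (real (b - a) * ln n)"
    and W_bdd: "\<forall>\<^sub>F k in sequentially. \<bar>W k\<bar> \<le> 2 * \<phi> k"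
  shows "(\<lambda>n. (real (R n) - real n / 2) / sqrt (2 * (v / (8 * \<mu>\<^sup>2)) * real n * ln (ln (real n))) - W (n div 2) / \<phi> (n div 2)) \<longlonglongrightarrow> 0"
proof -
  \<comment> \<open>Balance contributes 1 and each walk at most \<open>4 * sqrt (n * ln n)\<close>;
    the final 1 pays for replacing \<open>n / 2\<close> by \<open>n div 2\<close>. \<open>E\<close>
    repeats the estimate with windows of length at most \<open>B n\<close>.\<close>
  define B where "B n = (1 + 8 * sqrt (real n * ln (real n))) / (2 * \<mu>) + 1" for n
  define E where "E n = 1 + 8 * sqrt (B n * ln (real n))" for n
  \<comment> \<open>The normalization of the conclusion multiplied by
    \<open>2 * \<mu>\<close>.\<close>
  define \<rho> where "\<rho> n = sqrt (v * real n * ln (ln (real n)))" for n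
  define c where "c n = \<phi> (n div 2) / \<rho> n" for n
  have close: "\<forall>\<^sub>F n in sequentially. \<bar>2 * \<mu> * (real (R n) - real n / 2) - W (n div 2)\<bar> \<le> E n"
    using incr_u incr_w eventually_ge_at_top[of 1]
  proof eventually_elim
    case (elim n)
    define k where "k = n div 2"
    have ln: "ln (real n) \<ge> 0" using elim by simp
    \<comment> \<open>Both orders of \<open>a\<close> and \<open>b\<close> occur: \<open>R n\<close>
      may lie on either side of \<open>n div 2\<close>.\<close>
    have diff: "\<bar>(\<Sum>j<a. f j) - (\<Sum>j<b. f j)\<bar> \<le> 4 * sqrt (\<bar>real a - real b\<bar> * ln n)"
      if f: "\<forall>a b. a \<le> b \<longrightarrow> b \<le> n \<longrightarrow> \<bar>\<Sum>i\<in>{a..<b}. f i\<bar> \<le> 4 * sqrt (real (b - a) * ln n)"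
        and ab: "a \<le> n" "b \<le> n" for f :: "nat \<Rightarrow> real" and a b
    proof (cases "a \<le> b")
      case True
      then have "(\<Sum>j<b. f j) - (\<Sum>j<a. f j) = (\<Sum>i\<in>{a..<b}. f i)"
        by (simp add: sum_diff_nat_ivl lessThan_atLeast0)
      then show ?thesis using f[rule_format, OF True ab(2)] True
        by (simp add: of_nat_diff abs_minus_commute)
    next
      case False
      then have "(\<Sum>j<a. f j) - (\<Sum>j<b. f j) = (\<Sum>i\<in>{b..<a}. f i)"
        by (simp add: sum_diff_nat_ivl lessThan_atLeast0)
      then show ?thesis using f[rule_format, of b a] ab False
        by (simp add: of_nat_diff)
    qed
    have crude: "\<bar>\<Sum>j<a. f j\<bar> \<le> 4 * sqrt (real n * ln n)"
      if f: "\<forall>a b. a \<le> b \<longrightarrow> b \<le> n \<longrightarrow> \<bar>\<Sum>i\<in>{a..<b}. f i\<bar> \<le> 4 * sqrt (real (b - a) * ln n)"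
        and a: "a \<le> n" for f :: "nat \<Rightarrow> real" and a
    proof -
      have "\<bar>\<Sum>j<a. f j\<bar> \<le> 4 * sqrt (real a * ln n)" using diff[OF f a, of 0] by simp
      also have "\<dots> \<le> 4 * sqrt (real n * ln n)"
        using a ln by (intro mult_left_mono real_sqrt_le_mono mult_right_mono) auto
      finally show ?thesis .
    qed
    have nR: "n - R n \<le> n" "real (n - R n) = real n - real (R n)" using R[of n] by (auto simp: of_nat_diff)
    have eq: "2 * \<mu> * (real (R n) - real n / 2) = \<mu> * real (R n) - \<mu> * real (n - R n)"
      unfolding nR(2) by (simp add: algebra_simps)
    have "\<bar>2 * \<mu> * (real (R n) - real n / 2)\<bar> \<le> 1 + 8 * sqrt (real n * ln n)"
      unfolding eq using balanced[of n] crude[OF elim(1) R[of n]] crude[OF elim(2) nR(1)] by linarith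
    then have "2 * \<mu> * \<bar>real (R n) - real n / 2\<bar> \<le> 1 + 8 * sqrt (real n * ln n)"
      using \<mu> by (simp add: abs_mult)
    then have Rn: "\<bar>real (R n) - real n / 2\<bar> \<le> B n - 1"
      unfolding B_def using \<mu> by (simp add: field_simps)
    have k: "\<bar>real k - real n / 2\<bar> \<le> 1" "k \<le> n"
      using real_half_bounds[of n] by (auto simp: k_def abs_le_iff)
    have win: "\<bar>real (R n) - real k\<bar> \<le> B n" "\<bar>real (n - R n) - real k\<bar> \<le> B n"
      unfolding nR(2) using Rn k by linarith+
    have near: "\<bar>(\<Sum>j<a. f j) - (\<Sum>j<k. f j)\<bar> \<le> 4 * sqrt (B n * ln n)"
      if "\<forall>a b. a \<le> b \<longrightarrow> b \<le> n \<longrightarrow> \<bar>\<Sum>i\<in>{a..<b}. f i\<bar> \<le> 4 * sqrt (real (b - a) * ln n)"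
        and "a \<le> n" "\<bar>real a - real k\<bar> \<le> B n" for f :: "nat \<Rightarrow> real" and a
    proof -
      have "4 * sqrt (\<bar>real a - real k\<bar> * ln n) \<le> 4 * sqrt (B n * ln n)"
        using that ln by (intro mult_left_mono real_sqrt_le_mono mult_right_mono) auto
      then show ?thesis using diff[OF that(1,2) k(2)] by linarith
    qed
    have "W k = (\<Sum>j<k. w j) - (\<Sum>j<k. u j)" by (simp add: W_def sum_subtractf)
    then show ?case
      unfolding eq E_def k_def[symmetric] using balanced[of n] near[OF elim(1) R[of n] win(1)] near[OF elim(2) nR(1) win(2)]
      by linarith
  qed
  \<comment> \<open>\<open>B n\<close> is of order \<open>sqrt (n * ln n)\<close>, so
    \<open>E n\<close> is of order \<open>n powr (1 / 4) * ln n powr (3 / 4)\<close>, far below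
    \<open>sqrt n\<close>.\<close>
  have E_lim: "(\<lambda>n. E n / \<rho> n) \<longlonglongrightarrow> 0"
    unfolding E_def B_def \<rho>_def using \<mu> v by real_asymp
  have c_lim: "c \<longlonglongrightarrow> 1"
    using LIL_normalization_halved[OF v] by (simp add: c_def[abs_def] \<phi>_def \<rho>_def)
  have \<phi>_pos: "\<forall>\<^sub>F k in sequentially. \<phi> k > 0"
    unfolding \<phi>_def using v by real_asymp
  have \<rho>_pos: "\<forall>\<^sub>F n in sequentially. \<rho> n > 0"
    unfolding \<rho>_def using v by real_asymp
  have "(\<lambda>n. E n / \<rho> n + 2 * \<bar>c n - 1\<bar>) \<longlonglongrightarrow> 0 + 2 * \<bar>1 - 1\<bar>"
    by (intro tendsto_intros E_lim c_lim)
  then have lim0: "(\<lambda>n. E n / \<rho> n + 2 * \<bar>c n - 1\<bar>) \<longlonglongrightarrow> 0" by simp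
  show ?thesis
  proof (rule tendsto_0_le[OF lim0, where K = 1])
    show "\<forall>\<^sub>F n in sequentially. norm ((real (R n) - real n / 2) / sqrt (2 * (v / (8 * \<mu>\<^sup>2)) * real n * ln (ln (real n)))
        - W (n div 2) / \<phi> (n div 2)) \<le> norm (E n / \<rho> n + 2 * \<bar>c n - 1\<bar>) * 1"
      using close \<rho>_pos eventually_compose_filterlim[OF W_bdd filterlim_half_nat] eventually_compose_filterlim[OF \<phi>_pos filterlim_half_nat]
    proof eventually_elim
      case (elim n)
      define D where "D = 2 * \<mu> * (real (R n) - real n / 2) - W (n div 2)"
      define b where "b = W (n div 2) / \<phi> (n div 2)"
      have "sqrt (2 * (v / (8 * \<mu>\<^sup>2)) * real n * ln (ln (real n))) = \<rho> n / (2 * \<mu>)"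
      proof -
        have "2 * (v / (8 * \<mu>\<^sup>2)) * real n * ln (ln (real n)) = (v * real n * ln (ln (real n))) / (2 * \<mu>)\<^sup>2"
          by (simp add: field_simps power2_eq_square)
        then show ?thesis using \<mu> by (simp only: \<rho>_def real_sqrt_divide real_sqrt_abs)
      qed
      then have "(real (R n) - real n / 2) / sqrt (2 * (v / (8 * \<mu>\<^sup>2)) * real n * ln (ln (real n)))
          = (2 * \<mu> * (real (R n) - real n / 2)) / \<rho> n"
        using \<mu> by simp
      \<comment> \<open>Exchanging \<open>\<phi> (n div 2)\<close> for \<open>\<rho> n\<close> is a
        multiplicative error, so it vanishes because \<open>b\<close> stays bounded; this is the
        purpose of \<open>W_bdd\<close>.\<close>
      also have "\<dots> = D / \<rho> n + b * c n"
        unfolding D_def b_def c_def using elim by (simp add: diff_divide_distrib)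
      finally have "(real (R n) - real n / 2) / sqrt (2 * (v / (8 * \<mu>\<^sup>2)) * real n * ln (ln (real n))) - b
          = D / \<rho> n + b * (c n - 1)" (is "?lhs = _")
        by (simp add: algebra_simps)
      then have "\<bar>?lhs\<bar> \<le> \<bar>D / \<rho> n\<bar> + \<bar>b * (c n - 1)\<bar>"
        by (simp only: abs_triangle_ineq)
      moreover have "\<bar>D / \<rho> n\<bar> \<le> E n / \<rho> n"
        using elim by (simp add: D_def abs_divide divide_right_mono)
      moreover have "\<bar>b * (c n - 1)\<bar> \<le> 2 * \<bar>c n - 1\<bar>"
      proof -
        have "\<bar>b\<bar> \<le> 2" unfolding b_def using elim by (simp add: abs_divide divide_le_eq)
        then show ?thesis unfolding abs_mult by (intro mult_right_mono) auto
      qed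
      ultimately have "\<bar>?lhs\<bar> \<le> E n / \<rho> n + 2 * \<bar>c n - 1\<bar>" by (rule order.trans[OF _ add_mono])
      then show ?case unfolding b_def[symmetric] real_norm_def by simp
    qed
  qed
qed

section \<open>Greedy policies\<close>

lemma readR_Suc: "readR C (Suc n) \<omega> = readR C n \<omega> + C (Suc n) \<omega>"
  by (simp add: readR_def)

lemma readR_le:
  assumes "\<And>n. n \<ge> 1 \<Longrightarrow> C n \<omega> \<in> {0, 1}"
  shows "readR C n \<omega> \<le> n"
proof (induction n)
  case (Suc n)
  then show ?case using assms[of "Suc n"] by (auto simp: readR_Suc)
qed (simp add: readR_def)

text \<open>A record is read only from a source whose counter is not ahead. So the step, of size at
  most 1, moves the difference towards 0 or past it, and from 0 it reaches at most 1 on either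
  side.\<close>

lemma greedy_balanced:
  fixes f g :: "nat \<Rightarrow> real"
  assumes f: "\<And>i. 0 \<le> f i" "\<And>i. f i \<le> 1" and g: "\<And>i. 0 \<le> g i" "\<And>i. g i \<le> 1"
    and C01: "\<And>n. n \<ge> 1 \<Longrightarrow> C n \<omega> \<in> {0, 1}"
    and greedy: "\<And>n. n \<ge> 1 \<Longrightarrow>
        (Gam f LS (readS C n \<omega>) \<omega> > Gam g LR (readR C n \<omega>) \<omega> \<longrightarrow> C (n + 1) \<omega> = 1) \<and>
        (Gam f LS (readS C n \<omega>) \<omega> < Gam g LR (readR C n \<omega>) \<omega> \<longrightarrow> C (n + 1) \<omega> = 0)"
  shows "\<bar>Gam f LS (readS C n \<omega>) \<omega> - Gam g LR (readR C n \<omega>) \<omega>\<bar> \<le> 1"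
proof (induction n)
  case 0
  show ?case by (simp add: readR_def readS_def Gam_def)
next
  case (Suc n)
  define D where "D n = Gam f LS (readS C n \<omega>) \<omega> - Gam g LR (readR C n \<omega>) \<omega>" for n
  have Gam_Suc: "Gam h L (Suc m) \<omega> = Gam h L m \<omega> + h (L (Suc m) \<omega>)" for h :: "nat \<Rightarrow> real" and L :: "nat \<Rightarrow> 'a \<Rightarrow> nat" and m
    by (simp add: Gam_def)
  have le: "readR C n \<omega> \<le> n" using C01 by (rule readR_le)
  have D0: "D 0 = 0" by (simp add: D_def readR_def readS_def Gam_def)
  have IH: "\<bar>D n\<bar> \<le> 1" using Suc by (simp add: D_def)
  have "C (Suc n) \<omega> \<in> {0, 1}" using C01[of "Suc n"] by simp
  then consider "C (Suc n) \<omega> = 1" | "C (Suc n) \<omega> = 0" by auto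
  then have "\<bar>D (Suc n)\<bar> \<le> 1"
  proof cases
    case 1
    \<comment> \<open>The greedy rule starts at \<open>n = 1\<close>; the first read is
      unconstrained, but then the counters are equal.\<close>
    have "D n \<ge> 0"
    proof (cases "n = 0")
      case False
      then have "\<not> D n < 0" using greedy[of n] 1 by (auto simp: D_def)
      then show ?thesis by simp
    qed (simp add: D0)
    moreover have "D (Suc n) = D n - g (LR (Suc (readR C n \<omega>)) \<omega>)"
      using 1 by (simp add: D_def readR_Suc readS_def Gam_Suc)
    ultimately show ?thesis using IH g[of "LR (Suc (readR C n \<omega>)) \<omega>"] by linarith
  next
    case 2
    have "D n \<le> 0"
    proof (cases "n = 0")
      case False
      then have "\<not> D n > 0" using greedy[of n] 2 by (auto simp: D_def)
      then show ?thesis by simp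
    qed (simp add: D0)
    moreover have "D (Suc n) = D n + f (LS (Suc (readS C n \<omega>)) \<omega>)"
      using 2 le by (simp add: D_def readR_Suc readS_def Gam_Suc Suc_diff_le)
    ultimately show ?thesis using IH f[of "LS (Suc (readS C n \<omega>)) \<omega>"] by linarith
  qed
  then show ?case by (simp add: D_def)
qed

text \<open>The right-hand side does not mention \<open>L\<close>; this is how the steps of each
  walk are later seen to have a common law.\<close>

lemma (in prob_space) distr_nat_label:
  fixes L :: "'a \<Rightarrow> nat"
  assumes L: "L \<in> measurable M (count_space UNIV)"
    and pmf: "\<And>i. prob {\<omega>\<in>space M. L \<omega> = i} = p i"
  shows "distr M (count_space UNIV) L = density (count_space UNIV) (\<lambda>i. ennreal (p i))"
proof (rule measure_eqI_countable)
  fix a :: nat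
  have "emeasure (distr M (count_space UNIV) L) {a} = emeasure M {\<omega>\<in>space M. L \<omega> = a}"
    using L by (subst emeasure_distr) (auto intro!: arg_cong[where f = "emeasure M"])
  also have "\<dots> = ennreal (p a)" by (simp add: emeasure_eq_measure pmf)
  also have "\<dots> = emeasure (density (count_space UNIV) (\<lambda>i. ennreal (p i))) {a}"
    by (subst emeasure_density) (auto simp: nn_integral_indicator_singleton)
  finally show "emeasure (distr M (count_space UNIV) L) {a} = emeasure (density (count_space UNIV) (\<lambda>i. ennreal (p i))) {a}" .
qed (auto simp: uncountable_def)

lemma (in prob_space) expectation_nat_label:
  fixes L :: "'a \<Rightarrow> nat" and f :: "nat \<Rightarrow> real"
  assumes L: "L \<in> measurable M (count_space UNIV)"
    and pmf: "\<And>i. prob {\<omega>\<in>space M. L \<omega> = i} = p i"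
    and p: "\<And>i. 0 \<le> p i" "summable p" and f: "\<And>i. 0 \<le> f i" "\<And>i. f i \<le> 1"
  shows "expectation (\<lambda>\<omega>. f (L \<omega>)) = (\<Sum>i. p i * f i)"
proof -
  have "expectation (\<lambda>\<omega>. f (L \<omega>)) = integral\<^sup>L (distr M (count_space UNIV) L) f"
    using L by (subst integral_distr) auto
  also have "\<dots> = (\<integral>i. p i * f i \<partial>count_space UNIV)"
    unfolding distr_nat_label[OF L pmf] using p by (subst integral_density) auto
  also have "\<dots> = (\<Sum>i. p i * f i)"
  proof (rule integral_count_space_nat)
    have "summable (\<lambda>i. p i * f i)"
      by (rule summable_comparison_test[OF _ p(2)]) (use p f in \<open>auto simp: abs_mult mult_left_le intro!: exI[of _ 0]\<close>)
    then show "integrable (count_space UNIV) (\<lambda>i. p i * f i)"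
      using p f by (simp add: integrable_count_space_nat_iff abs_mult)
  qed
  finally show ?thesis .
qed

lemma nonneg_sums_1_le_1:
  fixes p :: "nat \<Rightarrow> real"
  assumes "\<And>i. 0 \<le> p i" "p sums 1"
  shows "p i \<le> 1"
  using sum_le_suminf[of p "{i}"] assms by (auto simp: sums_iff)

theorem theorem3p3:
  fixes M :: "'a measure" and r s :: "nat \<Rightarrow> real"
    and LR LS C :: "nat \<Rightarrow> 'a \<Rightarrow> nat" and F0 :: "'a set set"
  defines "\<mu> \<equiv> (\<Sum>i. r i * s i)"
    and "varR \<equiv> prob_space.variance M (\<lambda>\<omega>. s (LR 1 \<omega>))"
    and "varS \<equiv> prob_space.variance M (\<lambda>\<omega>. r (LS 1 \<omega>))"
  defines "\<sigma>2 \<equiv> (varR + varS) / (8 * \<mu>\<^sup>2)"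
  assumes M: "prob_space M"
    and r_nonneg: "\<forall>i. r i \<ge> 0" and r0: "r 0 = 0" and r_sum: "r sums 1"
    and s_nonneg: "\<forall>i. s i \<ge> 0" and s0: "s 0 = 0" and s_sum: "s sums 1"
    and mu_pos: "\<mu> > 0"
    and indep: "prob_space.indep_vars M (\<lambda>_. count_space UNIV) (case_sum LR LS) ({1..} <+> {1..})"
    and distR: "\<forall>n\<ge>1. \<forall>i. measure M {\<omega>\<in>space M. LR n \<omega> = i} = r i"
    and distS: "\<forall>n\<ge>1. \<forall>i. measure M {\<omega>\<in>space M. LS n \<omega> = i} = s i"
    and var_pos: "sqrt varR + sqrt varS > 0"
    and F0: "sigma_algebra (space M) F0" "F0 \<subseteq> sets M"
    and F0_indep: "prob_space.indep_set M F0 (label_sets M LR LS)"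
    and C01: "\<forall>n\<ge>1. \<forall>\<omega>\<in>space M. C n \<omega> \<in> {0, 1}"
    and adapted: "\<forall>n\<ge>1. C n \<in> measurable (filt M F0 LR LS C (n - 1)) (count_space UNIV)"
    and greedy: "\<forall>n\<ge>1. \<forall>\<omega>\<in>space M.
        (Gam r LS (readS C n \<omega>) \<omega> > Gam s LR (readR C n \<omega>) \<omega> \<longrightarrow> C (n + 1) \<omega> = 1) \<and>
        (Gam r LS (readS C n \<omega>) \<omega> < Gam s LR (readR C n \<omega>) \<omega> \<longrightarrow> C (n + 1) \<omega> = 0)"
  shows "AE \<omega> in M.
     limsup (\<lambda>n. ereal ((real (readR C n \<omega>) - real n / 2) / sqrt (2 * \<sigma>2 * real n * ln (ln (real n))))) = 1
   \<and> liminf (\<lambda>n. ereal ((real (readR C n \<omega>) - real n / 2) / sqrt (2 * \<sigma>2 * real n * ln (ln (real n))))) = -1"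
proof -
  interpret prob_space M by (rule M)
  have r1: "0 \<le> r i" "r i \<le> 1" and s1: "0 \<le> s i" "s i \<le> 1" for i
    using r_nonneg s_nonneg nonneg_sums_1_le_1 r_sum s_sum by auto
  define v where "v = varR + varS"
  have var_nonneg: "varR \<ge> 0" "varS \<ge> 0" by (simp_all add: varR_def varS_def)
  have v_pos: "v > 0"
  proof -
    have "\<not> (varR = 0 \<and> varS = 0)" using var_pos by auto
    then show ?thesis using var_nonneg by (auto simp: v_def)
  qed

  have meas_LR: "LR n \<in> measurable M (count_space UNIV)" and meas_LS: "LS n \<in> measurable M (count_space UNIV)"
    if "n \<ge> 1" for n
    using indep that by (auto simp: indep_vars_def dest: bspec[of _ _ "Inl n"] bspec[of _ _ "Inr n"])
  \<comment> \<open>Labels are numbered from 1 and walks from 0, hence the shift by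
    \<open>Suc\<close>.\<close>
  define u where "u n \<omega> = s (LR (Suc n) \<omega>) - \<mu>" for n \<omega>
  define w where "w n \<omega> = r (LS (Suc n) \<omega>) - \<mu>" for n \<omega>
  define Y where "Y n \<omega> = w n \<omega> - u n \<omega>" for n \<omega>
  have meas_s: "(\<lambda>\<omega>. s (LR (Suc n) \<omega>)) \<in> borel_measurable M" and meas_r: "(\<lambda>\<omega>. r (LS (Suc n) \<omega>)) \<in> borel_measurable M" for n
    by (rule measurable_compose[OF meas_LR] measurable_compose[OF meas_LS]; simp)+
  note [measurable] = meas_s meas_r
  have [measurable]: "u n \<in> borel_measurable M" "w n \<in> borel_measurable M" for n
    unfolding u_def w_def by measurable
  have mean_s: "expectation (\<lambda>\<omega>. s (LR (Suc n) \<omega>)) = \<mu>" for n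
    unfolding \<mu>_def using r_sum s1 r1 distR by (intro expectation_nat_label[OF meas_LR]) (auto simp: sums_iff)
  have mean_r: "expectation (\<lambda>\<omega>. r (LS (Suc n) \<omega>)) = \<mu>" for n
  proof -
    have "expectation (\<lambda>\<omega>. r (LS (Suc n) \<omega>)) = (\<Sum>i. s i * r i)"
      using s_sum s1 r1 distS by (intro expectation_nat_label[OF meas_LS]) (auto simp: sums_iff)
    then show ?thesis by (simp add: \<mu>_def mult.commute)
  qed
  have int_s[simp]: "integrable M (\<lambda>\<omega>. s (LR (Suc n) \<omega>))" for n
    by (rule integrable_const_bound[of _ 1]) (use s1 in auto)
  have int_r[simp]: "integrable M (\<lambda>\<omega>. r (LS (Suc n) \<omega>))" for n
    by (rule integrable_const_bound[of _ 1]) (use r1 in auto)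
  have \<mu>1: "0 \<le> \<mu>" "\<mu> \<le> 1"
  proof -
    have "expectation (\<lambda>\<omega>. s (LR (Suc 0) \<omega>)) \<le> expectation (\<lambda>_. 1)"
      by (intro integral_mono) (use s1 in auto)
    then show "\<mu> \<le> 1" by (simp add: mean_s prob_space)
  qed (use mu_pos in simp)
  have bdd: "\<bar>u n \<omega>\<bar> \<le> 1" "\<bar>w n \<omega>\<bar> \<le> 1" "\<bar>Y n \<omega>\<bar> \<le> 1" for n \<omega>
    using s1[of "LR (Suc n) \<omega>"] r1[of "LS (Suc n) \<omega>"] \<mu>1 by (auto simp: u_def w_def Y_def abs_le_iff)
  have mean0: "expectation (u n) = 0" "expectation (w n) = 0" for n
    by (simp_all add: u_def[abs_def] w_def[abs_def] mean_s mean_r prob_space)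
  have int_uw[simp]: "integrable M (u n)" "integrable M (w n)"
      "integrable M (\<lambda>\<omega>. (u n \<omega>)\<^sup>2)" "integrable M (\<lambda>\<omega>. (w n \<omega>)\<^sup>2)" for n
    by (rule integrable_const_bound[of _ 1]; use bdd in \<open>auto simp: abs_square_le_1\<close>)+

  have distr_u: "distr M borel (u n) = distr (density (count_space UNIV) (\<lambda>i. ennreal (r i))) borel (\<lambda>i. s i - \<mu>)" for n
    unfolding distr_nat_label[OF meas_LR distR[rule_format], of "Suc n", symmetric, simplified]
    by (subst distr_distr) (auto simp: comp_def u_def[abs_def] meas_LR)
  have distr_w: "distr M borel (w n) = distr (density (count_space UNIV) (\<lambda>i. ennreal (s i))) borel (\<lambda>i. r i - \<mu>)" for n
    unfolding distr_nat_label[OF meas_LS distS[rule_format], of "Suc n", symmetric, simplified]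
    by (subst distr_distr) (auto simp: comp_def w_def[abs_def] meas_LS)
  have second_u: "expectation (\<lambda>\<omega>. (u n \<omega>)\<^sup>2) = varR" for n
  proof -
    have "expectation (\<lambda>\<omega>. (u n \<omega>)\<^sup>2) = integral\<^sup>L (distr M borel (u n)) (\<lambda>x. x\<^sup>2)"
      by (subst integral_distr) auto
    also have "\<dots> = integral\<^sup>L (distr M borel (u 0)) (\<lambda>x. x\<^sup>2)"
      unfolding distr_u ..
    also have "\<dots> = varR"
      by (subst integral_distr) (auto simp: varR_def u_def mean_s[of 0, simplified])
    finally show ?thesis .
  qed
  have second_w: "expectation (\<lambda>\<omega>. (w n \<omega>)\<^sup>2) = varS" for n
  proof -
    have "expectation (\<lambda>\<omega>. (w n \<omega>)\<^sup>2) = integral\<^sup>L (distr M borel (w n)) (\<lambda>x. x\<^sup>2)"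
      by (subst integral_distr) auto
    also have "\<dots> = integral\<^sup>L (distr M borel (w 0)) (\<lambda>x. x\<^sup>2)"
      unfolding distr_w ..
    also have "\<dots> = varS"
      by (subst integral_distr) (auto simp: varS_def w_def mean_r[of 0, simplified])
    finally show ?thesis .
  qed

  \<comment> \<open>Pairing the two labels of each index gives independent pairs; choosing
    \<open>F\<close> then yields independence of \<open>u\<close>, of \<open>w\<close> and of their
    difference from one fact.\<close>
  have grouped: "indep_vars (\<lambda>_. borel)
      (\<lambda>n \<omega>. F (restrict (\<lambda>i. case_sum LR LS i \<omega>) {Inl (Suc n), Inr (Suc n)} (Inl (Suc n)))
               (restrict (\<lambda>i. case_sum LR LS i \<omega>) {Inl (Suc n), Inr (Suc n)} (Inr (Suc n)))) UNIV"
    for F :: "nat \<Rightarrow> nat \<Rightarrow> real"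
  proof (rule indep_vars_compose2[where Y = "\<lambda>n g. F (g (Inl (Suc n))) (g (Inr (Suc n)))"])
    show "indep_vars (\<lambda>n. PiM {Inl (Suc n), Inr (Suc n)} (\<lambda>_. count_space UNIV))
      (\<lambda>n \<omega>. restrict (\<lambda>i. case_sum LR LS i \<omega>) {Inl (Suc n), Inr (Suc n)}) UNIV"
      by (rule indep_vars_restrict[OF indep]) (auto simp: disjoint_family_on_def)
    show "(\<lambda>g. F (g (Inl (Suc n))) (g (Inr (Suc n)))) \<in> borel_measurable (PiM {Inl (Suc n), Inr (Suc n)} (\<lambda>_. count_space UNIV))" for n
    proof -
      \<comment> \<open>On a countable product the product sigma-algebra is discrete, so an
        arbitrary \<open>F\<close> is measurable.\<close>
      have "(\<lambda>g. (g (Inl (Suc n)), g (Inr (Suc n)))) \<in> measurable (PiM {Inl (Suc n), Inr (Suc n)} (\<lambda>_. count_space (UNIV::nat set)))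
          (count_space UNIV \<Otimes>\<^sub>M count_space UNIV)"
        by measurable
      then have "(\<lambda>g. (g (Inl (Suc n)), g (Inr (Suc n)))) \<in> measurable (PiM {Inl (Suc n), Inr (Suc n)} (\<lambda>_. count_space (UNIV::nat set)))
          (count_space UNIV)"
        by (simp add: pair_measure_countable)
      from measurable_compose[OF this, of "\<lambda>(a, b). F a b" borel] show ?thesis by simp
    qed
  qed
  have grouped: "indep_vars (\<lambda>_. borel) (\<lambda>n \<omega>. F (LR (Suc n) \<omega>) (LS (Suc n) \<omega>)) UNIV"
    for F :: "nat \<Rightarrow> nat \<Rightarrow> real"
    using grouped[of F] by simp
  have indep_u: "indep_vars (\<lambda>_. borel) u UNIV"
    using grouped[of "\<lambda>a b. s a - \<mu>"] by (simp add: u_def[abs_def])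
  have indep_w: "indep_vars (\<lambda>_. borel) w UNIV"
    using grouped[of "\<lambda>a b. r b - \<mu>"] by (simp add: w_def[abs_def])
  have indep_Y: "indep_vars (\<lambda>_. borel) Y UNIV"
    using grouped[of "\<lambda>a b. (r b - \<mu>) - (s a - \<mu>)"] by (simp add: Y_def[abs_def] u_def w_def)
  have indep_uw: "indep_var borel (u n) borel (w n)" for n
  proof -
    have "indep_var borel ((\<lambda>g. s (g (Inl (Suc n))) - \<mu>) \<circ> (\<lambda>\<omega>. restrict (\<lambda>i. case_sum LR LS i \<omega>) {Inl (Suc n)}))
        borel ((\<lambda>g. r (g (Inr (Suc n))) - \<mu>) \<circ> (\<lambda>\<omega>. restrict (\<lambda>i. case_sum LR LS i \<omega>) {Inr (Suc n)}))"
    proof (rule indep_var_compose[OF indep_var_restrict[OF indep]])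
      show "(\<lambda>g. s (g (Inl (Suc n))) - \<mu>) \<in> borel_measurable (PiM {Inl (Suc n)} (\<lambda>_. count_space UNIV))"
        by (rule measurable_compose[OF measurable_component_singleton]) auto
      show "(\<lambda>g. r (g (Inr (Suc n))) - \<mu>) \<in> borel_measurable (PiM {Inr (Suc n)} (\<lambda>_. count_space UNIV))"
        by (rule measurable_compose[OF measurable_component_singleton]) auto
    qed auto
    then show ?thesis by (simp add: comp_def u_def[abs_def] w_def[abs_def])
  qed

  interpret Y: centered_iid M Y v
  proof unfold_locales
    show "indep_vars (\<lambda>_. borel) Y UNIV" by (rule indep_Y)
    show "expectation (Y n) = 0" for n
      by (simp add: Y_def[abs_def] mean0)
    show "expectation (\<lambda>\<omega>. (Y n \<omega>)\<^sup>2) = v" for n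
    proof -
      have uw: "integrable M (\<lambda>\<omega>. u n \<omega> * w n \<omega>)" "expectation (\<lambda>\<omega>. u n \<omega> * w n \<omega>) = 0"
        using indep_var_integrable[OF indep_uw] indep_var_lebesgue_integral[OF indep_uw] by (simp_all add: mean0)
      have "expectation (\<lambda>\<omega>. (Y n \<omega>)\<^sup>2) = expectation (\<lambda>\<omega>. (w n \<omega>)\<^sup>2 + (u n \<omega>)\<^sup>2 - 2 * (u n \<omega> * w n \<omega>))"
        by (simp add: Y_def power2_diff mult_ac)
      also have "\<dots> = v" using uw by (simp add: second_u second_w v_def)
      finally show ?thesis .
    qed
    \<comment> \<open>\<open>Y n\<close> is the sum of the independent \<open>w n\<close> and
      \<open>- u n\<close>; its characteristic function is a product of two factors that do not
      depend on \<open>n\<close>.\<close>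
    show "distr M borel (Y n) = distr M borel (Y 0)" for n
    proof (intro Levy_uniqueness real_distribution_distr ext)
      fix t
      have indep_uw': "indep_var borel (\<lambda>\<omega>. - u n \<omega>) borel (w n)" for n
        using indep_var_compose[OF indep_uw, of uminus borel id borel] by (simp add: comp_def)
      have dm: "distr M borel (\<lambda>\<omega>. - u i \<omega>) = distr (distr M borel (u i)) borel uminus" for i
        by (subst distr_distr) (simp_all add: comp_def)
      have "char (distr M borel (Y i)) t = char (distr M borel (\<lambda>\<omega>. - u 0 \<omega>)) t * char (distr M borel (w 0)) t" for i
        using char_distr_add[OF indep_uw', of i t] unfolding dm distr_u distr_w by (simp add: Y_def[abs_def])
      then show "char (distr M borel (Y n)) t = char (distr M borel (Y 0)) t" by simp
    qed (simp_all add: Y_def[abs_def])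
  qed (use bdd v_pos in auto)

  \<comment> \<open>Countably many margins \<open>1 / Suc j\<close> replace all real ones, so a
    single null set serves for them all.\<close>
  have W_upper: "AE \<omega> in M. \<forall>\<^sub>F n in sequentially. Y.S n \<omega> \<le> (1 + 1 / Suc j) * Y.\<phi> n" for j
    using Y.S_upper[of "1 + 1 / Suc j"]
    by (auto elim!: eventually_mono less_imp_le)
  have W_lower: "AE \<omega> in M. \<exists>\<^sub>F n in sequentially. Y.S n \<omega> \<ge> (1 - 1 / Suc j) * Y.\<phi> n" for j
    using Y.S_lower[of "1 / Suc j"] by simp
  interpret Y': centered_iid M "\<lambda>n \<omega>. - Y n \<omega>" v by (rule Y.centered_iid_uminus)
  have W_upper': "AE \<omega> in M. \<forall>\<^sub>F n in sequentially. - Y.S n \<omega> \<le> (1 + 1 / Suc j) * Y.\<phi> n" for j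
    using Y'.S_upper[of "1 + 1 / Suc j"] unfolding Y.S_uminus
    by (auto elim!: eventually_mono less_imp_le)
  have W_lower': "AE \<omega> in M. \<exists>\<^sub>F n in sequentially. - Y.S n \<omega> \<ge> (1 - 1 / Suc j) * Y.\<phi> n" for j
    using Y'.S_lower[of "1 / Suc j"] unfolding Y.S_uminus by simp
  have "AE \<omega> in M. (\<forall>j. \<forall>\<^sub>F n in sequentially. Y.S n \<omega> \<le> (1 + 1 / Suc j) * Y.\<phi> n)
     \<and> (\<forall>j. \<exists>\<^sub>F n in sequentially. Y.S n \<omega> \<ge> (1 - 1 / Suc j) * Y.\<phi> n)
     \<and> (\<forall>j. \<forall>\<^sub>F n in sequentially. - Y.S n \<omega> \<le> (1 + 1 / Suc j) * Y.\<phi> n)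
     \<and> (\<forall>j. \<exists>\<^sub>F n in sequentially. - Y.S n \<omega> \<ge> (1 - 1 / Suc j) * Y.\<phi> n)"
    unfolding AE_conj_iff AE_all_countable using W_upper W_lower W_upper' W_lower' by blast
  moreover have "AE \<omega> in M. \<forall>\<^sub>F n in sequentially. \<forall>a b. a \<le> b \<longrightarrow> b \<le> n \<longrightarrow>
      \<bar>\<Sum>i\<in>{a..<b}. u i \<omega>\<bar> \<le> 4 * sqrt (real (b - a) * ln n)"
    using bdd mean0 by (intro bounded_increments_AE indep_u)
  moreover have "AE \<omega> in M. \<forall>\<^sub>F n in sequentially. \<forall>a b. a \<le> b \<longrightarrow> b \<le> n \<longrightarrow>
      \<bar>\<Sum>i\<in>{a..<b}. w i \<omega>\<bar> \<le> 4 * sqrt (real (b - a) * ln n)"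
    using bdd mean0 by (intro bounded_increments_AE indep_w)
  ultimately show ?thesis using AE_space
  proof eventually_elim
    case (elim \<omega>)
    note \<omega> = \<open>\<omega> \<in> space M\<close>
    have C: "\<And>n. n \<ge> 1 \<Longrightarrow> C n \<omega> \<in> {0, 1}" using C01 \<omega> by auto
    have R: "readR C n \<omega> \<le> n" for n using C by (rule readR_le)
    have "\<bar>Gam r LS (readS C n \<omega>) \<omega> - Gam s LR (readR C n \<omega>) \<omega>\<bar> \<le> 1" for n
      using r1 s1 C greedy[rule_format, OF _ \<omega>] by (intro greedy_balanced) auto
    moreover have "Gam s LR m \<omega> = \<mu> * real m + (\<Sum>j<m. u j \<omega>)" "Gam r LS m \<omega> = \<mu> * real m + (\<Sum>j<m. w j \<omega>)" for m
      by (induction m) (auto simp: Gam_def u_def w_def algebra_simps)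
    ultimately have balanced: "\<bar>(\<mu> * real (n - readR C n \<omega>) + (\<Sum>j<n - readR C n \<omega>. w j \<omega>))
        - (\<mu> * real (readR C n \<omega>) + (\<Sum>j<readR C n \<omega>. u j \<omega>))\<bar> \<le> 1" for n
      by (simp add: readS_def)
    have S_eq: "(\<Sum>j<k. w j \<omega> - u j \<omega>) = Y.S k \<omega>" for k
      by (simp add: Y.S_def Y_def)
    have \<phi>_pos: "\<forall>\<^sub>F n in sequentially. Y.\<phi> (real n) > 0"
      unfolding Y.\<phi>_def using v_pos by real_asymp
    \<comment> \<open>The sign \<open>e\<close> treats the walk, for the limsup, and its negative,
      for the liminf, at once.\<close>
    have ub: "\<forall>\<^sub>F k in sequentially. e * Y.S k \<omega> / Y.\<phi> (real k) \<le> 1 + d"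
      and lb: "\<exists>\<^sub>F k in sequentially. e * Y.S k \<omega> / Y.\<phi> (real k) \<ge> 1 - d"
      if e: "e = 1 \<or> e = -1" and d: "d > 0" for d e :: real
    proof -
      obtain j where j: "1 / Suc j < d" using nat_approx_posE[OF d] by blast
      have U: "\<forall>\<^sub>F k in sequentially. e * Y.S k \<omega> \<le> (1 + 1 / Suc j) * Y.\<phi> k" using e elim(1) by auto
      then show "\<forall>\<^sub>F k in sequentially. e * Y.S k \<omega> / Y.\<phi> (real k) \<le> 1 + d" using \<phi>_pos
      proof eventually_elim
        case (elim k)
        have "(1 + 1 / Suc j) * Y.\<phi> k \<le> (1 + d) * Y.\<phi> k" using j elim by (intro mult_right_mono) auto
        then have "e * Y.S k \<omega> \<le> (1 + d) * Y.\<phi> k" using elim by linarith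
        then show ?case by (subst pos_divide_le_eq) (use elim in auto)
      qed
      have "\<exists>\<^sub>F k in sequentially. e * Y.S k \<omega> \<ge> (1 - 1 / Suc j) * Y.\<phi> k" using e elim(1) by auto
      from frequently_eventually_conj[OF this \<phi>_pos]
      show "\<exists>\<^sub>F k in sequentially. e * Y.S k \<omega> / Y.\<phi> (real k) \<ge> 1 - d"
      proof (rule frequently_elim1)
        fix k assume k: "0 < Y.\<phi> (real k) \<and> (1 - 1 / Suc j) * Y.\<phi> k \<le> e * Y.S k \<omega>"
        have "(1 - d) * Y.\<phi> k \<le> (1 - 1 / Suc j) * Y.\<phi> k" using j k by (intro mult_right_mono) auto
        then have "(1 - d) * Y.\<phi> k \<le> e * Y.S k \<omega>" using k by linarith
        then show "1 - d \<le> e * Y.S k \<omega> / Y.\<phi> (real k)" by (subst pos_le_divide_eq) (use k in auto)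
      qed
    qed
    have W_bdd: "\<forall>\<^sub>F k in sequentially. \<bar>Y.S k \<omega>\<bar> \<le> 2 * Y.\<phi> k"
      using ub[of 1 1, simplified] ub[of "-1" 1, simplified] \<phi>_pos
      by eventually_elim (simp add: abs_le_iff field_simps)
    define a where "a n = (real (readR C n \<omega>) - real n / 2) / sqrt (2 * \<sigma>2 * real n * ln (ln (real n)))" for n
    have lim: "(\<lambda>n. a n - Y.S (n div 2) \<omega> / Y.\<phi> (n div 2)) \<longlonglongrightarrow> 0"
      using balanced_walks_close[of v \<mu> "\<lambda>n. readR C n \<omega>" "\<lambda>j. w j \<omega>" "\<lambda>j. u j \<omega>", OF v_pos mu_pos R balanced elim(2,3)] W_bdd
      unfolding S_eq Y.\<phi>_def a_def[abs_def] \<sigma>2_def v_def[symmetric] by blast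
    have "limsup (\<lambda>n. ereal (a n)) = 1"
      using ub[of 1] lb[of 1] lim by (intro limsup_halved_eq_1[of "\<lambda>k. Y.S k \<omega> / Y.\<phi> k"]) auto
    moreover have "limsup (\<lambda>n. ereal (- a n)) = 1"
    proof (rule limsup_halved_eq_1[of "\<lambda>k. - 1 * Y.S k \<omega> / Y.\<phi> k"])
      show "(\<lambda>n. - a n - - 1 * Y.S (n div 2) \<omega> / Y.\<phi> (n div 2)) \<longlonglongrightarrow> 0"
        using tendsto_minus[OF lim] by (simp add: algebra_simps)
    qed (use ub[of "-1"] lb[of "-1"] in auto)
    then have "liminf (\<lambda>n. ereal (a n)) = - 1"
      using ereal_Limsup_uminus[of sequentially "\<lambda>n. ereal (a n)"] by (simp add: ereal_uminus_eq_reorder)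
    ultimately show ?case unfolding a_def by blast
  qed
qed

end
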